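(* Let $T>0$ and $m\in\mathbb{R}$, let $1<\alpha\le 2$ and $0\le\beta\le 2-\alpha$. Consider the equation $$(D_{0+}^\alpha u)(t)-m\,u(t)=f(t),\qquad 0<t<T, \qquad (\mathrm{E})$$ and, for real numbers $\hat c_1,\hat c_2$, the initial conditions $$\Gamma(\alpha+\beta-1)\,t^{2-\alpha-\beta}\,(I_{0+}^\beta u)(t)\Big|_{t=0}=\hat c_1,\qquad (D_{0+}^\gamma u)(t)\Big|_{t=0}=\hat c_2. \qquad (\mathrm{IC})$$ **(A)** Let $0<\gamma\le\alpha-1$. Suppose $f\in C^1_{-1}[0,T]$ if $1<\alpha<2$, and $f\in C_{-1}[0,T]$ if $\alpha=2$. Then the equation (E) with the homogeneous initial conditions (IC), $\hat c_1=\hat c_2=0$, has a unique solution $u_f\in C^2_{-1}[0,T]$, and it is given by $$u_f(t)=\int_0^t f(t-s)\,s^{\alpha-1}E_{\alpha,\alpha}(ms^\alpha)\,ds.$$ **(B)** Let $\gamma=\alpha-1$ and $f\equiv 0$. Then the equation (E) with the non-homogeneous initial conditions (IC) has a unique solution $u_0$, and it is given by $$u_0(t)=\hat c_2\,t^{\alpha-1}E_{\alpha,\alpha}(mt^\alpha)+\hat c_1\,t^{\alpha-2}E_{\alpha,\alpha-1}(mt^\alpha).$$ Moreover, $$\Gamma(\alpha+\beta-1)\,t^{2-\alpha-\beta}I_{0+}^\beta[t^{\alpha-1}E_{\alpha,\alpha}(mt^\alpha)]\Big|_{t=0}=0,\qquad D_{0+}^\gamma[t^{\alpha-1}E_{\alpha,\alpha}(mt^\alpha)]\Big|_{t=0}=1,$$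 and $$\Gamma(\alpha+\beta-1)\,t^{2-\alpha-\beta}I_{0+}^\beta[t^{\alpha-2}E_{\alpha,\alpha-1}(mt^\alpha)]\Big|_{t=0}=1,\qquad D_{0+}^\gamma[t^{\alpha-2}E_{\alpha,\alpha-1}(mt^\alpha)]\Big|_{t=0}=0.$$
   Context: For $\beta>0$ the Riemann–Liouville fractional integral is $(I_{0+}^\beta u)(t)=\frac{1}{\Gamma(\beta)}\int_0^t (t-s)^{\beta-1}u(s)\,ds$, and $I_{0+}^0$ is the identity. For $\alpha>0$ and $n=[\alpha]+1$ (with $[\cdot]$ the integer part), the Riemann–Liouville fractional derivative is $$(D_{0+}^\alpha u)(t)=\Big(\frac{d}{dt}\Big)^n (I_{0+}^{n-\alpha}u)(t)=\frac{1}{\Gamma(n-\alpha)}\Big(\frac{d}{dt}\Big)^n\int_0^t\frac{u(s)\,ds}{(t-s)^{\alpha-n+1}};$$ for integer order it is the ordinary derivative. The notation $|_{t=0}$ means the limit as $t\to0+$. The two-parameter Mittag-Leffler function is $E_{\alpha,\beta}(z)=\sum_{k=0}^\infty \frac{z^k}{\Gamma(\alpha k+\beta)}$, with the convention $1/\Gamma(0)=0$. A complex-valued function $f$ belongs to $C_{-1}[0,T]$ if there is a real $p>-1$ with $f(x)=x^p f_1(x)$ for some $f_1\in C[0,T]$. For $k\in\mathbb{N}_0$, $f\in C^k_{-1}[0,T]$ means $f^{(k)}\in C_{-1}[0,T]$.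
   Formalization: In (A) uniqueness is claimed only for α<2 or γ=1: for α=2, 0<γ<1 it fails (β=m=0, f=0: u=t and u=0 both solve the problem); existence and formula hold for all γ. In (B), where no solution class is named, uniqueness is among functions continuous on (0,T). *)

theory Defs
  imports "HOL-Analysis.Analysis"
begin

text \<open>
  Functions on $(0,T]$ or $(0,T)$ are total functions \<open>real \<Rightarrow> complex\<close>; only their values on the
  relevant interval matter. Integrals are Lebesgue integrals.
\<close>

text \<open>On an open interval the derivatives are two-sided; at an endpoint belonging to \<open>S\<close> they are
  one-sided.\<close>

primrec has_nth_derivative_on ::
    "nat \<Rightarrow> (real \<Rightarrow> complex) \<Rightarrow> (real \<Rightarrow> complex) \<Rightarrow> real set \<Rightarrow> bool" where
  "has_nth_derivative_on 0 u g S \<longleftrightarrow> (\<forall>t\<in>S. g t = u t)"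
| "has_nth_derivative_on (Suc n) u g S \<longleftrightarrow>
     (\<exists>v. (\<forall>t\<in>S. (u has_vector_derivative v t) (at t within S)) \<and> has_nth_derivative_on n v g S)"

definition C_minus1 :: "real \<Rightarrow> (real \<Rightarrow> complex) set" where
  "C_minus1 T = {f. \<exists>p>-1. \<exists>f1. continuous_on {0..T} f1 \<and> (\<forall>x\<in>{0<..T}. f x = (x powr p) *\<^sub>R f1 x)}"

definition Ck_minus1 :: "nat \<Rightarrow> real \<Rightarrow> (real \<Rightarrow> complex) set" where
  "Ck_minus1 k T = {f. \<exists>g. has_nth_derivative_on k f g {0<..T} \<and> g \<in> C_minus1 T}"

definition RL_integral :: "real \<Rightarrow> (real \<Rightarrow> complex) \<Rightarrow> real \<Rightarrow> complex" where
  "RL_integral \<beta> u t =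
     (if \<beta> = 0 then u t
      else (1 / Gamma \<beta>) *\<^sub>R (LBINT s=0..t. ((t - s) powr (\<beta> - 1)) *\<^sub>R u s))"

definition RL_integral_exists :: "real \<Rightarrow> (real \<Rightarrow> complex) \<Rightarrow> real \<Rightarrow> bool" where
  "RL_integral_exists \<beta> u t \<longleftrightarrow>
     \<beta> = 0 \<or> interval_lebesgue_integrable lborel 0 t (\<lambda>s. ((t - s) powr (\<beta> - 1)) *\<^sub>R u s)"

text \<open>\<open>has_RL_derivative \<alpha> u g T\<close>: the Riemann--Liouville derivative of order \<open>\<alpha> > 0\<close> of \<open>u\<close> exists
  on $(0,T)$ and equals \<open>g\<close> there. Integer orders are a separate case because
  the ordinary derivative requires no integrability of \<open>u\<close> near 0.\<close>

definition has_RL_derivative ::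
    "real \<Rightarrow> (real \<Rightarrow> complex) \<Rightarrow> (real \<Rightarrow> complex) \<Rightarrow> real \<Rightarrow> bool" where
  "has_RL_derivative \<alpha> u g T \<longleftrightarrow>
     (if \<alpha> \<in> \<int> then has_nth_derivative_on (nat \<lfloor>\<alpha>\<rfloor>) u g {0<..<T}
      else (let n = nat \<lfloor>\<alpha>\<rfloor> + 1 in
        (\<forall>t\<in>{0<..<T}. RL_integral_exists (real n - \<alpha>) u t) \<and>
        has_nth_derivative_on n (RL_integral (real n - \<alpha>) u) g {0<..<T}))"

text \<open>\<open>rGamma\<close> is the reciprocal of \<open>Gamma\<close>, with value 0 at the poles.\<close>

definition mittag_leffler :: "real \<Rightarrow> real \<Rightarrow> complex \<Rightarrow> complex" where
  "mittag_leffler \<alpha> \<beta> z = (\<Sum>k. rGamma (\<alpha> * real k + \<beta>) *\<^sub>R z ^ k)"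

definition solves_equation ::
    "real \<Rightarrow> real \<Rightarrow> real \<Rightarrow> (real \<Rightarrow> complex) \<Rightarrow> (real \<Rightarrow> complex) \<Rightarrow> bool" where
  "solves_equation T \<alpha> m f u \<longleftrightarrow>
     (\<exists>g. has_RL_derivative \<alpha> u g T \<and> (\<forall>t\<in>{0<..<T}. g t - of_real m * u t = f t))"

definition initial_condition1 ::
    "real \<Rightarrow> real \<Rightarrow> real \<Rightarrow> (real \<Rightarrow> complex) \<Rightarrow> complex \<Rightarrow> bool" where
  "initial_condition1 T \<alpha> \<beta> u c \<longleftrightarrow>
     (\<forall>t\<in>{0<..<T}. RL_integral_exists \<beta> u t) \<and>
     ((\<lambda>t. (Gamma (\<alpha> + \<beta> - 1) * t powr (2 - \<alpha> - \<beta>)) *\<^sub>R RL_integral \<beta> u t) \<longlongrightarrow> c) (at_right 0)"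

definition initial_condition2 ::
    "real \<Rightarrow> real \<Rightarrow> (real \<Rightarrow> complex) \<Rightarrow> complex \<Rightarrow> bool" where
  "initial_condition2 T \<gamma> u c \<longleftrightarrow> (\<exists>g. has_RL_derivative \<gamma> u g T \<and> (g \<longlongrightarrow> c) (at_right 0))"

definition solves_problem ::
    "real \<Rightarrow> real \<Rightarrow> real \<Rightarrow> real \<Rightarrow> real \<Rightarrow> (real \<Rightarrow> complex) \<Rightarrow> real \<Rightarrow> real \<Rightarrow> (real \<Rightarrow> complex) \<Rightarrow> bool"
  where
  "solves_problem T \<alpha> \<beta> \<gamma> m f c1 c2 u \<longleftrightarrow>
     solves_equation T \<alpha> m f u \<and>
     initial_condition1 T \<alpha> \<beta> u (of_real c1) \<and>
     initial_condition2 T \<gamma> u (of_real c2)"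

end

theory Submission
  imports Defs
begin

text \<open>
  Write \<open>*\<close> for causal convolution, \<open>g(b)\<close> for the kernel \<open>t powr (b - 1) / Gamma b\<close> of the fractional
  integral \<open>I(b)\<close>, and \<open>G(b)\<close> for \<open>t powr (b - 1)\<close> times the Mittag-Leffler function with parameters
  \<open>\<alpha>, b\<close> at \<open>m * t powr \<alpha>\<close>. Then \<open>g(a) * g(b) = g(a + b)\<close>, \<open>g(c) * G(b) = G(b + c)\<close> and
  \<open>G(b) = g(b) + m G(b + \<alpha>)\<close>. Differentiation lowers the index by one, so for \<open>u = f * G(\<alpha>)\<close> the function
  \<open>I(2 - \<alpha>) u = f * G(2)\<close> has the derivatives \<open>f * G(1)\<close> and \<open>f + m u\<close>; the homogeneous solutions are
  \<open>G(\<alpha>)\<close> and \<open>G(\<alpha> - 1)\<close>.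

  For uniqueness let \<open>w\<close> be a difference of two solutions and \<open>V = I(2 - \<alpha>) w\<close>. The initial conditions
  force \<open>V\<close> and \<open>V'\<close> to vanish at 0, so \<open>V'' = m w\<close> integrates to \<open>V = m I(2) w = m I(\<alpha>) V\<close>. This
  Volterra equation gives \<open>V = 0\<close>, hence \<open>I(1) w = I(\<alpha> - 1) V = 0\<close> and \<open>w = 0\<close>.
\<close>

section \<open>Causal convolution\<close>

text \<open>The unknown w may blow up like t powr (\<alpha> - 2) at 0, and in (B) only continuity on
  the open interval is assumed of it beyond the problem itself. The Volterra argument therefore runs
  on V, which has a limit at 0, and with kernel index \<alpha> \<ge> 1, so that the kernel is
  bounded. The delicate point is how the initial conditions reach V and V'. For \<gamma> = \<alpha>
  - 1 the second condition speaks of V' itself, while the first controls only I(\<beta>) w with a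
  weight and must be integrated up to order 2 - \<alpha>. For \<gamma> < \<alpha> - 1 the second
  condition is not about V', and the regularity C^2_{-1} has to help: it gives w = a + I(1) k with k
  continuous up to 0, the condition forces a = 0, and V' = I(2 - \<alpha>) k tends to 0. That last
  limit needs \<alpha> < 2, which is why \<alpha> = 2 with \<gamma> < 1 is left out of the
  uniqueness claim.\<close>

definition conv :: "(real \<Rightarrow> complex) \<Rightarrow> (real \<Rightarrow> complex) \<Rightarrow> real \<Rightarrow> complex" where
  "conv f g t = (LINT s:{0<..<t}|lborel. f (t - s) * g s)"

text \<open>A non-integrable integrand has Bochner integral 0, so the value of \<open>conv\<close>
  says nothing about convergence; existence is carried as a separate predicate.\<close>

definition conv_exists :: "(real \<Rightarrow> complex) \<Rightarrow> (real \<Rightarrow> complex) \<Rightarrow> real \<Rightarrow> bool" where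
  "conv_exists f g t \<longleftrightarrow> set_integrable lborel {0<..<t} (\<lambda>s. f (t - s) * g s)"

lemma conv_cong:
  assumes "\<And>s. 0 < s \<Longrightarrow> s < t \<Longrightarrow> f s = f' s" "\<And>s. 0 < s \<Longrightarrow> s < t \<Longrightarrow> g s = g' s"
  shows "conv f g t = conv f' g' t"
  unfolding conv_def by (rule set_lebesgue_integral_cong) (auto simp: assms)

lemma conv_exists_cong:
  assumes "\<And>s. 0 < s \<Longrightarrow> s < t \<Longrightarrow> f s = f' s" "\<And>s. 0 < s \<Longrightarrow> s < t \<Longrightarrow> g s = g' s"
  shows "conv_exists f g t = conv_exists f' g' t"
  unfolding conv_exists_def by (rule set_integrable_cong) (auto simp: assms)

lemma conv_commute: "conv f g t = conv g f t"
  unfolding conv_def set_lebesgue_integral_def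
  by (subst lborel_integral_real_affine[where c = "-1" and t = t])
     (auto simp: indicator_def mult.commute intro!: Bochner_Integration.integral_cong)

lemma conv_add_right:
  assumes "conv_exists f g t" "conv_exists f h t"
  shows "conv f (\<lambda>s. g s + h s) t = conv f g t + conv f h t"
  using assms unfolding conv_def conv_exists_def by (simp add: distrib_left)

lemma conv_mult_right: "conv f (\<lambda>s. c * g s) t = c * conv f g t"
proof -
  have "f (t - s) * (c * g s) = c * (f (t - s) * g s)" for s
    by simp
  then show ?thesis
    unfolding conv_def by (simp only: set_integral_mult_right)
qed

lemma conv_exists_mult_right: "conv_exists f g t \<Longrightarrow> conv_exists f (\<lambda>s. c * g s) t"
proof -
  have "f (t - s) * (c * g s) = c * (f (t - s) * g s)" for s
    by simp
  then show "conv_exists f g t \<Longrightarrow> conv_exists f (\<lambda>s. c * g s) t"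
    unfolding conv_exists_def by (simp only: set_integrable_mult_right)
qed

text \<open>The bound is phrased as the real part of a complex convolution of majorants, so that the
  semigroup identities for the kernels evaluate it directly.\<close>

lemma norm_conv_le:
  assumes "conv_exists f g t" "conv_exists (\<lambda>s. of_real (p s)) (\<lambda>s. of_real (q s)) t"
    and "\<And>s. 0 < s \<Longrightarrow> s < t \<Longrightarrow> norm (f s) \<le> p s" "\<And>s. 0 < s \<Longrightarrow> s < t \<Longrightarrow> norm (g s) \<le> q s"
  shows "norm (conv f g t) \<le> Re (conv (\<lambda>s. of_real (p s)) (\<lambda>s. of_real (q s)) t)"
proof -
  have r: "set_integrable lborel {0<..<t} (\<lambda>s. p (t - s) * q s)"
    using assms(2) integrable_Re[of lborel "\<lambda>s. indicator {0<..<t} s *\<^sub>R (of_real (p (t - s)) * complex_of_real (q s))"]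
    unfolding conv_exists_def set_integrable_def by simp
  have eq: "Re (conv (\<lambda>s. of_real (p s)) (\<lambda>s. of_real (q s)) t) = (LINT s:{0<..<t}|lborel. p (t - s) * q s)"
    unfolding conv_def set_lebesgue_integral_def
    using assms(2)[unfolded conv_exists_def set_integrable_def]
    by (subst integral_Re[symmetric]) (auto)
  show ?thesis
    unfolding eq unfolding conv_def set_lebesgue_integral_def
  proof (rule Bochner_Integration.integral_norm_bound_integral)
    show "norm (indicator {0<..<t} s *\<^sub>R (f (t - s) * g s)) \<le> indicator {0<..<t} s *\<^sub>R (p (t - s) * q s)" for s
      using assms(3)[of "t - s"] assms(4)[of s] order_trans[OF norm_ge_zero assms(3), of "t - s"]
      by (auto simp: indicator_def norm_mult intro!: mult_mono)
  qed (use assms(1) r in \<open>auto simp: conv_exists_def set_integrable_def\<close>)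
qed

lemma conv_norm_eq:
  fixes f g :: "real \<Rightarrow> complex"
  shows "conv (\<lambda>s. of_real (norm (f s))) (\<lambda>s. of_real (norm (g s))) t =
     of_real (LINT s:{0<..<t}|lborel. norm (f (t - s) * g s))"
proof -
  have "conv (\<lambda>s. of_real (norm (f s))) (\<lambda>s. of_real (norm (g s))) t
      = (LINT s:{0<..<t}|lborel. complex_of_real (norm (f (t - s) * g s)))"
    unfolding conv_def by (simp add: norm_mult)
  then show ?thesis by (simp add: set_integral_complex_of_real)
qed

text \<open>Fubini for \<open>f (t - s) * g (s - r) * h r\<close> on the triangle \<open>0 < r < s < t\<close>; truncating all three
  functions to \<open>{0<..<t}\<close> makes the integrand on the whole plane vanish off that triangle.\<close>

lemma
  fixes f g h :: "real \<Rightarrow> complex"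
  assumes [measurable]: "set_borel_measurable borel {0<..<t} f" "set_borel_measurable borel {0<..<t} g"
      "set_borel_measurable borel {0<..<t} h"
    and fg: "\<And>x. 0 < x \<Longrightarrow> x < t \<Longrightarrow> conv_exists f g x"
    and fgh: "conv_exists (conv (\<lambda>s. of_real (norm (f s))) (\<lambda>s. of_real (norm (g s)))) h t"
  shows conv_assoc: "conv f (conv g h) t = conv (conv f g) h t"
    and conv_exists_assoc: "conv_exists f (conv g h) t"
proof -
  define F where "F = (\<lambda>s. indicator {0<..<t} s *\<^sub>R f s)"
  define G where "G = (\<lambda>s. indicator {0<..<t} s *\<^sub>R g s)"
  define H where "H = (\<lambda>s. indicator {0<..<t} s *\<^sub>R h s)"
  define K where "K = (\<lambda>r s. F (t - s) * G (s - r) * H r)"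
  have [measurable]: "F \<in> borel_measurable borel" "G \<in> borel_measurable borel" "H \<in> borel_measurable borel"
    using assms(1-3) unfolding F_def G_def H_def set_borel_measurable_def by auto
  \<comment> \<open>Substituting s -> r + s carries the strip r < s < t to (0, t - r); the
    truncations of F and G to (0, t) then amount to the single indicator of that interval.\<close>
  have shift: "F (t - (r + s)) * G (r + s - r) = indicator {0<..<t - r} s *\<^sub>R (f (t - r - s) * g s)"
    if "r \<in> {0<..<t}" for r s
    using that by (auto simp: F_def G_def indicator_def algebra_simps)
  have FG: "integrable lborel (\<lambda>s. F (t - s) * G (s - r))"
    and FGi: "(\<integral>s. F (t - s) * G (s - r) \<partial>lborel) = conv f g (t - r)"
    and FGn: "(\<integral>s. norm (F (t - s) * G (s - r)) \<partial>lborel)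
               = norm (conv (\<lambda>s. of_real (norm (f s))) (\<lambda>s. of_real (norm (g s))) (t - r))"
    if r: "r \<in> {0<..<t}" for r
  proof -
    show "integrable lborel (\<lambda>s. F (t - s) * G (s - r))"
      using fg[of "t - r"] r unfolding conv_exists_def set_integrable_def
      by (subst lborel_integrable_real_affine_iff[where c = 1 and t = r, symmetric])
         (simp_all only: mult_1 shift[OF r], auto)
    show "(\<integral>s. F (t - s) * G (s - r) \<partial>lborel) = conv f g (t - r)"
      unfolding conv_def set_lebesgue_integral_def
      by (subst lborel_integral_real_affine[where c = 1 and t = r])
         (simp_all only: mult_1 shift[OF r], auto)
    have "(\<integral>s. norm (F (t - s) * G (s - r)) \<partial>lborel) = (LINT s:{0<..<t - r}|lborel. norm (f (t - r - s) * g s))"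
      unfolding set_lebesgue_integral_def
      by (subst lborel_integral_real_affine[where c = 1 and t = r])
         (simp_all only: mult_1 shift[OF r], auto)
    moreover have "\<dots> \<ge> 0"
      by (auto simp: set_lebesgue_integral_def)
    ultimately show "(\<integral>s. norm (F (t - s) * G (s - r)) \<partial>lborel)
               = norm (conv (\<lambda>s. of_real (norm (f s))) (\<lambda>s. of_real (norm (g s))) (t - r))"
      unfolding conv_norm_eq by (simp only: norm_of_real abs_of_nonneg)
  qed
  have int: "integrable (lborel \<Otimes>\<^sub>M lborel) (\<lambda>(r, s). K r s)"
  proof (rule lborel_pair.Fubini_integrable)
    show "(\<lambda>(r, s). K r s) \<in> borel_measurable (lborel \<Otimes>\<^sub>M lborel)"
      unfolding K_def by measurable
    \<comment> \<open>The inner L1 norm is written as the norm of a convolution of moduli, so that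
      up to \<open>integrable_norm\<close> it is the integrand of the hypothesis
      \<open>fgh\<close>.\<close>
    have "(\<integral>s. norm (case (r, s) of (r, s) \<Rightarrow> K r s) \<partial>lborel)
        = norm (indicator {0<..<t} r *\<^sub>R (conv (\<lambda>s. of_real (norm (f s))) (\<lambda>s. of_real (norm (g s))) (t - r) * h r))" for r
    proof (cases "r \<in> {0<..<t}")
      case True
      have "(\<integral>s. norm (case (r, s) of (r, s) \<Rightarrow> K r s) \<partial>lborel)
         = (\<integral>s. norm (F (t - s) * G (s - r)) * norm (H r) \<partial>lborel)"
        by (simp add: K_def norm_mult)
      also have "\<dots> = (\<integral>s. norm (F (t - s) * G (s - r)) \<partial>lborel) * norm (H r)"
        by simp
      also have "\<dots> = norm (conv (\<lambda>s. of_real (norm (f s))) (\<lambda>s. of_real (norm (g s))) (t - r)) * norm (H r)"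
        by (simp only: FGn[OF True])
      finally show ?thesis
        using True by (simp add: H_def norm_mult)
    qed (simp add: K_def H_def)
    then show "integrable lborel (\<lambda>r. \<integral>s. norm (case (r, s) of (r, s) \<Rightarrow> K r s) \<partial>lborel)"
      using fgh unfolding conv_exists_def set_integrable_def by (simp only: integrable_norm)
    have "integrable lborel (\<lambda>s. K r s)" for r
    proof (cases "r \<in> {0<..<t}")
      case True
      then show ?thesis using FG by (auto simp: K_def)
    qed (simp add: K_def H_def)
    then show "AE r in lborel. integrable lborel (\<lambda>s. case (r, s) of (r, s) \<Rightarrow> K r s)"
      by simp
  qed
  have inner: "(\<integral>r. K r s \<partial>lborel) = indicator {0<..<t} s *\<^sub>R (f (t - s) * conv g h s)" for s
  proof (cases "s \<in> {0<..<t}")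
    case True
    have "(\<integral>r. K r s \<partial>lborel) = (\<integral>r. indicator {0<..<s} r *\<^sub>R (f (t - s) * (g (s - r) * h r)) \<partial>lborel)"
      using True by (intro Bochner_Integration.integral_cong) (auto simp: K_def F_def G_def H_def indicator_def)
    also have "\<dots> = (\<integral>r. f (t - s) * (indicator {0<..<s} r *\<^sub>R (g (s - r) * h r)) \<partial>lborel)"
      by (intro Bochner_Integration.integral_cong) auto
    also have "\<dots> = f (t - s) * conv g h s"
      unfolding conv_def set_lebesgue_integral_def by (rule integral_mult_right_zero)
    finally show ?thesis
      using True by simp
  qed (auto simp: K_def F_def)
  have outer: "(\<integral>s. K r s \<partial>lborel) = indicator {0<..<t} r *\<^sub>R (conv f g (t - r) * h r)" for r
  proof (cases "r \<in> {0<..<t}")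
    case True
    then have "(\<integral>s. K r s \<partial>lborel) = (\<integral>s. F (t - s) * G (s - r) \<partial>lborel) * H r"
      by (simp add: K_def)
    then show ?thesis
      using True by (simp add: FGi H_def)
  qed (simp add: K_def H_def)
  show "conv_exists f (conv g h) t"
    using lborel_pair.integrable_snd[OF int] unfolding conv_exists_def set_integrable_def inner .
  have "conv f (conv g h) t = (\<integral>s. \<integral>r. K r s \<partial>lborel \<partial>lborel)"
    unfolding conv_def[of f] set_lebesgue_integral_def inner ..
  also have "\<dots> = (\<integral>r. \<integral>s. K r s \<partial>lborel \<partial>lborel)"
    by (rule lborel_pair.Fubini_integral[OF int])
  also have "\<dots> = conv (conv f g) h t"
    unfolding conv_def[of "conv f g"] set_lebesgue_integral_def outer ..
  finally show "conv f (conv g h) t = conv (conv f g) h t" .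
qed

section \<open>Functions of the form $t^p$ times a continuous function\<close>

text \<open>\<open>C_minus1\<close> with its exponent made visible: convolution adds exponents plus
  one, weights shift them, and a positive exponent means limit 0 at the origin.\<close>

definition powr_cont :: "real \<Rightarrow> real \<Rightarrow> (real \<Rightarrow> complex) set" where
  "powr_cont p T = {f. \<exists>f1. continuous_on {0..T} f1 \<and> (\<forall>x\<in>{0<..T}. f x = (x powr p) *\<^sub>R f1 x)}"

lemma C_minus1_eq: "C_minus1 T = (\<Union>p\<in>{-1<..}. powr_cont p T)"
  by (auto simp: C_minus1_def powr_cont_def)

lemma powr_contI:
  "continuous_on {0..T} f1 \<Longrightarrow> (\<And>x. 0 < x \<Longrightarrow> x \<le> T \<Longrightarrow> f x = (x powr p) *\<^sub>R f1 x) \<Longrightarrow> f \<in> powr_cont p T"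
  unfolding powr_cont_def by auto

lemma powr_contE:
  assumes "f \<in> powr_cont p T"
  obtains f1 where "continuous_on {0..T} f1" "\<And>x. 0 < x \<Longrightarrow> x \<le> T \<Longrightarrow> f x = (x powr p) *\<^sub>R f1 x"
  using assms unfolding powr_cont_def by auto

lemma powr_cont_cong:
  assumes "f \<in> powr_cont p T" "\<And>x. 0 < x \<Longrightarrow> x \<le> T \<Longrightarrow> f x = g x"
  shows "g \<in> powr_cont p T"
  using assms unfolding powr_cont_def by auto

lemma powr_cont_add:
  assumes "f \<in> powr_cont p T" "g \<in> powr_cont p T"
  shows "(\<lambda>x. f x + g x) \<in> powr_cont p T"
proof -
  from assms(1) obtain f1 where f1: "continuous_on {0..T} f1" "\<And>x. 0 < x \<Longrightarrow> x \<le> T \<Longrightarrow> f x = (x powr p) *\<^sub>R f1 x"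
    by (rule powr_contE) blast
  from assms(2) obtain g1 where g1: "continuous_on {0..T} g1" "\<And>x. 0 < x \<Longrightarrow> x \<le> T \<Longrightarrow> g x = (x powr p) *\<^sub>R g1 x"
    by (rule powr_contE) blast
  show ?thesis
    by (rule powr_contI[where ?f1.0 = "\<lambda>x. f1 x + g1 x"])
       (auto simp: f1 g1 algebra_simps intro!: continuous_intros)
qed

lemma powr_cont_mult_left:
  assumes "f \<in> powr_cont p T"
  shows "(\<lambda>x. c * f x) \<in> powr_cont p T"
proof -
  from assms(1) obtain f1 where f1: "continuous_on {0..T} f1" "\<And>x. 0 < x \<Longrightarrow> x \<le> T \<Longrightarrow> f x = (x powr p) *\<^sub>R f1 x"
    by (rule powr_contE) blast
  show ?thesis
    by (rule powr_contI[where ?f1.0 = "\<lambda>x. c * f1 x"]) (auto simp: f1 intro!: continuous_intros)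
qed

lemma powr_cont_powr_scaleR:
  assumes "f \<in> powr_cont p T"
  shows "(\<lambda>x. (c * x powr q) *\<^sub>R f x) \<in> powr_cont (p + q) T"
proof -
  from assms(1) obtain f1 where f1: "continuous_on {0..T} f1" "\<And>x. 0 < x \<Longrightarrow> x \<le> T \<Longrightarrow> f x = (x powr p) *\<^sub>R f1 x"
    by (rule powr_contE) blast
  show ?thesis
    by (rule powr_contI[where ?f1.0 = "\<lambda>x. c *\<^sub>R f1 x"])
       (auto simp: f1 powr_add intro!: continuous_intros)
qed

lemma powr_cont_mono:
  assumes "f \<in> powr_cont p T" "q \<le> p"
  shows "f \<in> powr_cont q T"
\<comment> \<open>The case q = p is separate because \<open>0 powr 0 = 0\<close> makes
  \<open>x powr (p - q)\<close> discontinuous at 0.\<close>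
proof (cases "q = p")
  case False
  from assms(1) obtain f1 where f1: "continuous_on {0..T} f1" "\<And>x. 0 < x \<Longrightarrow> x \<le> T \<Longrightarrow> f x = (x powr p) *\<^sub>R f1 x"
    by (rule powr_contE) blast
  show ?thesis
    using assms False
    by (intro powr_contI[where ?f1.0 = "\<lambda>x. (x powr (p - q)) *\<^sub>R f1 x"])
       (auto simp: f1 powr_add[symmetric] intro!: continuous_intros continuous_on_powr')
qed (use assms in auto)

lemma powr_cont_norm:
  assumes "f \<in> powr_cont p T"
  shows "(\<lambda>x. of_real (norm (f x))) \<in> powr_cont p T"
proof -
  from assms(1) obtain f1 where f1: "continuous_on {0..T} f1" "\<And>x. 0 < x \<Longrightarrow> x \<le> T \<Longrightarrow> f x = (x powr p) *\<^sub>R f1 x"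
    by (rule powr_contE) blast
  show ?thesis
    by (rule powr_contI[where ?f1.0 = "\<lambda>x. of_real (norm (f1 x))"])
       (auto simp: f1 scaleR_conv_of_real norm_mult intro!: continuous_intros)
qed

lemma powr_cont_const: "(\<lambda>_. c) \<in> powr_cont 0 T"
  by (rule powr_contI[where ?f1.0 = "\<lambda>_. c"]) auto

lemma powr_cont_continuous_on:
  assumes "f \<in> powr_cont p T"
  shows "continuous_on {0<..T} f"
proof -
  from assms(1) obtain f1 where f1: "continuous_on {0..T} f1" "\<And>x. 0 < x \<Longrightarrow> x \<le> T \<Longrightarrow> f x = (x powr p) *\<^sub>R f1 x"
    by (rule powr_contE) blast
  have "continuous_on {0<..T} (\<lambda>x. (x powr p) *\<^sub>R f1 x)"
    by (intro continuous_intros continuous_on_subset[OF f1(1)]) auto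
  then show ?thesis
    by (subst continuous_on_cong[OF refl f1(2)]) auto
qed

lemma powr_cont_measurable:
  assumes "f \<in> powr_cont p T" "t \<le> T"
  shows "set_borel_measurable borel {0<..<t} f"
  unfolding set_borel_measurable_def
  using assms by (intro borel_measurable_continuous_on_indicator continuous_on_subset[OF powr_cont_continuous_on]) auto

lemma powr_cont_tendsto:
  assumes "f \<in> powr_cont 0 T" "0 < T"
  obtains l where "(f \<longlongrightarrow> l) (at_right 0)"
proof -
  from assms(1) obtain f1 where f1: "continuous_on {0..T} f1" "\<And>x. 0 < x \<Longrightarrow> x \<le> T \<Longrightarrow> f x = (x powr 0) *\<^sub>R f1 x"
    by (rule powr_contE) blast
  have "(f1 \<longlongrightarrow> f1 0) (at 0 within {0..T})"
    using f1(1) assms(2) by (auto simp: continuous_on_def)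
  then have "(f1 \<longlongrightarrow> f1 0) (at_right 0)"
    using assms(2) by (metis at_within_Icc_at_right)
  moreover have "eventually (\<lambda>x. f1 x = f x) (at_right 0)"
    using eventually_at_right_real[OF assms(2)] by eventually_elim (auto simp: f1)
  ultimately show ?thesis
    using that by (metis tendsto_cong)
qed

lemma powr_cont_tendsto_0:
  assumes "f \<in> powr_cont p T" "0 < T" "0 < p"
  shows "(f \<longlongrightarrow> 0) (at_right 0)"
proof -
  from assms(1) obtain f1 where f1: "continuous_on {0..T} f1" "\<And>x. 0 < x \<Longrightarrow> x \<le> T \<Longrightarrow> f x = (x powr p) *\<^sub>R f1 x"
    by (rule powr_contE) blast
  have "f1 \<in> powr_cont 0 T"
    by (rule powr_contI[OF f1(1)]) auto
  then obtain l where "(f1 \<longlongrightarrow> l) (at_right 0)"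
    by (rule powr_cont_tendsto[OF _ assms(2)])
  moreover have "((\<lambda>x. x powr p) \<longlongrightarrow> 0) (at_right 0)"
    using assms(3) by (intro tendsto_eq_intros tendsto_powr') (auto simp: eventually_at_filter)
  ultimately have "((\<lambda>x. (x powr p) *\<^sub>R f1 x) \<longlongrightarrow> 0 *\<^sub>R l) (at_right 0)"
    by (intro tendsto_intros)
  moreover have "eventually (\<lambda>x. (x powr p) *\<^sub>R f1 x = f x) (at_right 0)"
    using eventually_at_right_real[OF assms(2)] by eventually_elim (auto simp: f1)
  ultimately show ?thesis
    by (simp add: tendsto_cong)
qed

text \<open>The substitution \<open>s = t * x\<close> exhibits the convolution as \<open>t powr (p + q + 1)\<close> times an integral
  over \<open>{0<..<1}\<close> that depends continuously on \<open>t\<close> by dominated convergence.\<close>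

lemma
  assumes f: "f \<in> powr_cont p T" and g: "g \<in> powr_cont q T" and pq: "-1 < p" "-1 < q"
  shows powr_cont_conv: "conv f g \<in> powr_cont (p + q + 1) T"
    and powr_cont_conv_exists: "0 < t \<Longrightarrow> t \<le> T \<Longrightarrow> conv_exists f g t"
proof -
  from f obtain f1 where f1: "continuous_on {0..T} f1" "\<And>x. 0 < x \<Longrightarrow> x \<le> T \<Longrightarrow> f x = (x powr p) *\<^sub>R f1 x"
    by (rule powr_contE) blast
  from g obtain g1 where g1: "continuous_on {0..T} g1" "\<And>x. 0 < x \<Longrightarrow> x \<le> T \<Longrightarrow> g x = (x powr q) *\<^sub>R g1 x"
    by (rule powr_contE) blast
  \<comment> \<open>The integrand after the substitution, with the power of t taken out; t enters
    only through the continuous factors f1 and g1.\<close>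
  define k where "k = (\<lambda>t x. indicator {0<..<1} x *\<^sub>R ((x powr q * (1 - x) powr p) *\<^sub>R (f1 (t * (1 - x)) * g1 (t * x))))"
  have *: "t * x \<in> {0..T} \<and> t * (1 - x) \<in> {0..T}" if "t \<in> {0..T}" "0 < x" "x < 1" for t x
    using that mult_mono[of t T x 1] mult_mono[of t T "1 - x" 1] by auto
  obtain B where B: "\<And>x. x \<in> {0..T} \<Longrightarrow> norm (f1 x) \<le> B"
    using compact_imp_bounded[OF compact_continuous_image[OF f1(1) compact_Icc]] unfolding bounded_iff by (metis imageI)
  obtain C where C: "\<And>x. x \<in> {0..T} \<Longrightarrow> norm (g1 x) \<le> C"
    using compact_imp_bounded[OF compact_continuous_image[OF g1(1) compact_Icc]] unfolding bounded_iff by (metis imageI)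
  \<comment> \<open>A Beta density times the bounds of f1 and g1 dominates k uniformly in t; its
    integrability is where both exponents must exceed -1.\<close>
  define w where "w = (\<lambda>x. (indicator {0..1} x *\<^sub>R (x powr q * (1 - x) powr p)) * (B * C))"
  have w: "integrable lborel w"
    using integrable_Beta[of "q + 1" "p + 1"] pq unfolding w_def set_integrable_def by simp
  have kw: "norm (k t x) \<le> w x" if "t \<in> {0..T}" for t x
  proof (cases "x \<in> {0<..<1}")
    case True
    then have "norm (f1 (t * (1 - x)) * g1 (t * x)) \<le> B * C"
      using *[OF that, of x] B[of "t * (1 - x)"] C[of "t * x"] order_trans[OF norm_ge_zero B, of "t * (1 - x)"]
      unfolding norm_mult by (intro mult_mono) auto
    then show ?thesis
      using True by (auto simp: k_def w_def intro!: mult_left_mono)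
  next
    case False
    \<comment> \<open>At the endpoints w is 0 because \<open>0 powr _ = 0\<close>, so the sign of B
      * C does not matter.\<close>
    then have "x = 0 \<or> x = 1 \<or> x \<notin> {0..1}" by auto
    then show ?thesis by (auto simp: k_def w_def indicator_def)
  qed
  have k_meas [measurable]: "k t \<in> borel_measurable borel" if "t \<in> {0..T}" for t
    unfolding k_def
    by (intro borel_measurable_continuous_on_indicator continuous_intros
          continuous_on_compose2[OF f1(1)] continuous_on_compose2[OF g1(1)])
       (use *[OF that] in auto)
  have k_int: "integrable lborel (k t)" if "t \<in> {0..T}" for t
    using w
    by (rule Bochner_Integration.integrable_bound)
       (use k_meas[OF that] in \<open>auto intro!: AE_I2 order_trans[OF kw[OF that]]\<close>)
  have kconv: "indicator {0<..<t} (0 + t * x) *\<^sub>R (f (t - (0 + t * x)) * g (0 + t * x)) = (t powr (p + q)) *\<^sub>R k t x"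
    if t: "0 < t" "t \<le> T" for t x
  proof (cases "x \<in> {0<..<1}")
    case True
    then have "t * x < t" "0 < t * x" "0 < 1 - x" using t by auto
    moreover have "t - t * x = t * (1 - x)" by (simp add: algebra_simps)
    moreover have "0 < t * (1 - x)" "t * (1 - x) \<le> T" "t * x \<le> T"
      using * [of t x] t True by auto
    then have "f (t * (1 - x)) = (t powr p * (1 - x) powr p) *\<^sub>R f1 (t * (1 - x))"
        "g (t * x) = (t powr q * x powr q) *\<^sub>R g1 (t * x)"
      using t True by (auto simp: f1 g1 powr_mult)
    ultimately show ?thesis
      using t True by (simp add: k_def powr_add mult_ac)
  next
    case False
    then show ?thesis using t by (auto simp: k_def indicator_def zero_less_mult_iff)
  qed
  show "conv_exists f g t" if t: "0 < t" "t \<le> T"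
    unfolding conv_exists_def set_integrable_def
    by (subst lborel_integrable_real_affine_iff[where c = t and t = 0, symmetric])
       (use t kconv[OF t] k_int[of t] in auto)
  have "conv f g t = (t powr (p + q + 1)) *\<^sub>R (\<integral>x. k t x \<partial>lborel)" if t: "0 < t" "t \<le> T" for t
    unfolding conv_def set_lebesgue_integral_def
    by (subst lborel_integral_real_affine[where c = t and t = 0])
       (use t in \<open>simp_all only: kconv[OF t], auto simp: powr_add\<close>)
  moreover have "continuous_on {0..T} (\<lambda>t. \<integral>x. k t x \<partial>lborel)"
    unfolding continuous_on_sequentially comp_def
  proof safe
    fix X :: "nat \<Rightarrow> real" and a assume X: "\<forall>n. X n \<in> {0..T}" "a \<in> {0..T}" "X \<longlonglongrightarrow> a"
    show "(\<lambda>n. \<integral>x. k (X n) x \<partial>lborel) \<longlonglongrightarrow> (\<integral>x. k a x \<partial>lborel)"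
    proof (rule integral_dominated_convergence[OF _ _ w])
      show "AE x in lborel. (\<lambda>n. k (X n) x) \<longlonglongrightarrow> k a x"
      proof (rule AE_I2)
        fix x
        show "(\<lambda>n. k (X n) x) \<longlonglongrightarrow> k a x"
        proof (cases "x \<in> {0<..<1}")
          case True
          have "(\<lambda>n. f1 (X n * (1 - x))) \<longlonglongrightarrow> f1 (a * (1 - x))"
            by (rule continuous_on_tendsto_compose[OF f1(1)])
               (use X * True in \<open>auto intro!: tendsto_intros\<close>)
          moreover have "(\<lambda>n. g1 (X n * x)) \<longlonglongrightarrow> g1 (a * x)"
            by (rule continuous_on_tendsto_compose[OF g1(1)])
               (use X * True in \<open>auto intro!: tendsto_intros\<close>)
          ultimately show ?thesis
            unfolding k_def by (intro tendsto_intros)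
        qed (simp add: k_def)
      qed
    qed (use X kw k_meas in auto)
  qed
  ultimately show "conv f g \<in> powr_cont (p + q + 1) T"
    by (intro powr_contI)
qed

lemma powr_cont_conv_assoc:
  assumes f: "f \<in> powr_cont p T" and g: "g \<in> powr_cont q T" and h: "h \<in> powr_cont r T"
    and "-1 < p" "-1 < q" "-1 < r" "0 < t" "t \<le> T"
  shows "conv f (conv g h) t = conv (conv f g) h t"
proof (rule conv_assoc)
  show "conv_exists f g x" if "0 < x" "x < t" for x
    using that assms by (intro powr_cont_conv_exists[OF f g]) auto
  have "conv (\<lambda>s. of_real (norm (f s))) (\<lambda>s. of_real (norm (g s))) \<in> powr_cont (p + q + 1) T"
    using assms by (intro powr_cont_conv powr_cont_norm)
  then show "conv_exists (conv (\<lambda>s. of_real (norm (f s))) (\<lambda>s. of_real (norm (g s)))) h t"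
    using assms by (intro powr_cont_conv_exists[OF _ h, where p = "p + q + 1"]) auto
qed (use assms in \<open>auto intro!: powr_cont_measurable\<close>)

text \<open>Lets a fractional integral pass under a convolution: with f a kernel, I(c) of g * h
  becomes g * I(c) h.\<close>

lemma powr_cont_conv_commute_assoc:
  assumes f: "f \<in> powr_cont p T" and g: "g \<in> powr_cont q T" and h: "h \<in> powr_cont r T"
    and "-1 < p" "-1 < q" "-1 < r" "0 < t" "t \<le> T"
  shows "conv f (conv g h) t = conv g (conv f h) t"
proof -
  have "conv f (conv g h) t = conv (conv f g) h t"
    by (rule powr_cont_conv_assoc) fact+
  also have "\<dots> = conv (conv g f) h t"
    by (rule conv_cong) (auto simp: conv_commute)
  also have "\<dots> = conv g (conv f h) t"
    by (rule powr_cont_conv_assoc[symmetric]) fact+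
  finally show ?thesis .
qed

section \<open>Riemann--Liouville kernels and integrals\<close>

lemma conv_eq_interval_integral: "0 \<le> t \<Longrightarrow> conv f g t = (LBINT s=0..t. f (t - s) * g s)"
  by (simp add: conv_def interval_lebesgue_integral_def zero_ereal_def)

lemma interval_integrable_iff:
  "0 \<le> t \<Longrightarrow> interval_lebesgue_integrable lborel 0 (ereal t) f \<longleftrightarrow> set_integrable lborel {0<..<t} f"
  by (simp add: interval_lebesgue_integrable_def zero_ereal_def)

definition rl_kernel :: "real \<Rightarrow> real \<Rightarrow> complex" where
  "rl_kernel b s = of_real (rGamma b * s powr (b - 1))"

lemma rl_kernel_powr_cont: "rl_kernel b \<in> powr_cont (b - 1) T"
  by (rule powr_contI[where ?f1.0 = "\<lambda>_. of_real (rGamma b)"]) (auto simp: rl_kernel_def scaleR_conv_of_real)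

lemma rl_kernel_1: "0 < t \<Longrightarrow> rl_kernel 1 t = 1"
  by (simp add: rl_kernel_def)

text \<open>Scaling s = t * x leaves the Beta integral of b and a, whose Gamma quotient cancels
  against the normalising factors.\<close>

lemma conv_rl_kernel:
  assumes ab: "0 < a" "0 < b" and t: "0 < t"
  shows "conv (rl_kernel a) (rl_kernel b) t = rl_kernel (a + b) t"
proof -
  have *: "indicator {0<..<t} (0 + t * x) *\<^sub>R (rl_kernel a (t - (0 + t * x)) * rl_kernel b (0 + t * x))
      = of_real (rGamma a * rGamma b * t powr (a + b - 2) * (indicator {0<..<1} x *\<^sub>R (x powr (b - 1) * (1 - x) powr (a - 1))))" for x
  proof (cases "x \<in> {0<..<1}")
    case True
    moreover have "t - t * x = t * (1 - x)" by (simp add: algebra_simps)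
    moreover have "t powr (a + b - 2) = t powr (a - 1) * t powr (b - 1)"
      by (simp add: powr_add[symmetric])
    ultimately show ?thesis
      using t by (simp add: rl_kernel_def powr_mult mult_ac)
  next
    case False
    then show ?thesis using t by (auto simp: indicator_def zero_less_mult_iff)
  qed
  have B: "(LINT x:{0<..<1}|lborel. x powr (b - 1) * (1 - x) powr (a - 1)) = Beta b a"
  proof -
    have i: "set_integrable lborel {0<..<1} (\<lambda>x. x powr (b - 1) * (1 - x) powr (a - 1))"
      by (rule set_integrable_subset[OF integrable_Beta]) (use ab in auto)
    show ?thesis
      unfolding set_borel_integral_eq_integral(2)[OF i]
      by (rule integral_unique) (use has_integral_Beta_real[of b a] ab in \<open>simp add: has_integral_Icc_iff_Ioo\<close>)
  qed
  have "conv (rl_kernel a) (rl_kernel b) t =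
      t *\<^sub>R of_real (rGamma a * rGamma b * t powr (a + b - 2) * Beta b a)"
    unfolding conv_def set_lebesgue_integral_def B[symmetric]
    by (subst lborel_integral_real_affine[where c = t and t = 0])
       (use t in \<open>simp_all only: * integral_complex_of_real, simp_all\<close>)
  also have "t * t powr (a + b - 2) = t powr (a + b - 1)"
    using t by (simp add: powr_mult_base)
  then have "t *\<^sub>R of_real (rGamma a * rGamma b * t powr (a + b - 2) * Beta b a)
     = complex_of_real (rGamma a * rGamma b * t powr (a + b - 1) * Beta b a)"
    by (simp add: scaleR_conv_of_real flip: of_real_mult)
  also have "rGamma a * rGamma b * t powr (a + b - 1) * Beta b a = rGamma (a + b) * t powr (a + b - 1)"
  proof -
    have "Gamma a \<noteq> 0" "Gamma b \<noteq> 0"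
      using Gamma_real_pos[OF ab(1)] Gamma_real_pos[OF ab(2)] by linarith+
    then have "rGamma a * rGamma b * Beta b a = rGamma (a + b)"
      by (simp add: Beta_altdef rGamma_inverse_Gamma field_simps del: Gamma_eq_zero_iff)
    then show ?thesis
      by (metis mult.assoc mult.commute)
  qed
  finally show ?thesis
    by (simp add: rl_kernel_def[of "a + b"])
qed

section \<open>Primitives from 0 and the kernel of order one\<close>

lemma conv_rl_kernel_1: "0 \<le> t \<Longrightarrow> conv (rl_kernel 1) h t = (LBINT s=0..t. h s)"
  unfolding conv_eq_interval_integral
  by (rule interval_integral_cong) (auto simp: rl_kernel_1 einterval_iff)

lemma conv_exists_rl_kernel_1: "conv_exists (rl_kernel 1) h t \<longleftrightarrow> set_integrable lborel {0<..<t} h"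
  unfolding conv_exists_def by (rule set_integrable_cong) (auto simp: rl_kernel_1)

lemma powr_cont_integrable:
  assumes "f \<in> powr_cont p T" "-1 < p" "t \<le> T"
  shows "set_integrable lborel {0<..<t} f"
proof (cases "0 < t")
  case True
  then show ?thesis
    using powr_cont_conv_exists[OF rl_kernel_powr_cont[of 1] assms(1)] assms
    by (simp add: conv_exists_rl_kernel_1)
qed simp

text \<open>h may be unbounded at 0, so the fundamental theorem is applied from the interior point t
  / 2; the integral over (0, t / 2) only adds a constant.\<close>

lemma integral_from_0_has_vector_derivative:
  fixes h :: "real \<Rightarrow> complex"
  assumes h: "continuous_on {0<..T} h" "set_integrable lborel {0<..<T} h" and t: "0 < t" "t \<le> T"
  shows "((\<lambda>t. LBINT s=0..t. h s) has_vector_derivative h t) (at t within {0<..T})"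
proof -
  define e where "e = t / 2"
  have e: "0 < e" "e < t" using t by (auto simp: e_def)
  have "((\<lambda>x. (LBINT s=0..e. h s) + (LBINT s=e..x. h s)) has_vector_derivative 0 + h t) (at t within {e..T})"
    using e t by (intro has_vector_derivative_add has_vector_derivative_const interval_integral_FTC2
        continuous_on_subset[OF h(1)]) auto
  then have "((\<lambda>x. LBINT s=0..x. h s) has_vector_derivative h t) (at t within {e..T})"
  unfolding add_0
  proof (rule has_vector_derivative_transform[rotated 2])
    show "t \<in> {e..T}" using e t by auto
    fix x assume x: "x \<in> {e..T}"
    have "interval_lebesgue_integrable lborel (min 0 (min (ereal e) (ereal x))) (max 0 (max (ereal e) (ereal x))) h"
      using x e h(2) by (auto simp: min_def max_def interval_integrable_iff intro: set_integrable_subset)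
    then show "(LBINT s=0..x. h s) = (LBINT s=0..e. h s) + (LBINT s=e..x. h s)"
      by (rule interval_integral_sum[symmetric])
  qed
  moreover have "at t within {e..T} = at t within {0<..T}"
    by (rule at_within_nhd[of _ "{e<..}"]) (use e in auto)
  ultimately show ?thesis by simp
qed

lemma powr_cont_conv_1_has_derivative:
  assumes h: "h \<in> powr_cont p T" "-1 < p" and t: "0 < t" "t \<le> T"
  shows "(conv (rl_kernel 1) h has_vector_derivative h t) (at t within {0<..T})"
  using integral_from_0_has_vector_derivative[OF powr_cont_continuous_on powr_cont_integrable, OF h(1) h order_refl t]
  by (rule has_vector_derivative_transform[rotated 2]) (use t in \<open>auto simp: conv_rl_kernel_1\<close>)

text \<open>Improper form of the fundamental theorem, with a limit at 0 in place of an initial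
  value; it converts the derivatives of V into integral equations.\<close>

lemma antiderivative_eq_integral:
  fixes F h :: "real \<Rightarrow> complex"
  assumes "\<And>t. 0 < t \<Longrightarrow> t < T \<Longrightarrow> (F has_vector_derivative h t) (at t)"
    and h: "continuous_on {0<..<T} h" "set_integrable lborel {0<..<t} h" and l: "(F \<longlongrightarrow> l) (at_right 0)"
    and t: "0 < t" "t < T"
  shows "F t = l + (LBINT s=0..t. h s)"
proof -
  have "(LBINT s=ereal 0..ereal t. h s) = F t - l"
  proof (rule interval_integral_FTC_integrable)
    show "(F has_vector_derivative h x) (at x)" if "ereal 0 < ereal x" "ereal x < ereal t" for x
      using assms(1)[of x] that t by auto
    show "isCont h x" if "ereal 0 < ereal x" "ereal x < ereal t" for x
      using h(1) that t by (auto simp: continuous_on_eq_continuous_at)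
    show "set_integrable lborel (einterval (ereal 0) (ereal t)) h"
      using h(2) by simp
    show "((F \<circ> real_of_ereal) \<longlongrightarrow> l) (at_right (ereal 0))"
      using l by (subst ereal_tendsto_simps)
    have "isCont F t"
      using assms(1)[of t] t by (auto dest: has_vector_derivative_continuous)
    then have "(F \<longlongrightarrow> F t) (at_left t)"
      by (simp add: isCont_def filterlim_at_split)
    then show "((F \<circ> real_of_ereal) \<longlongrightarrow> F t) (at_left (ereal t))"
      by (subst ereal_tendsto_simps)
  qed (use t in auto)
  then show ?thesis by (simp add: zero_ereal_def)
qed

section \<open>The Riemann-Liouville integral as a convolution\<close>

lemma RL_integral_0: "RL_integral 0 u = u"
  by (auto simp: RL_integral_def)

lemma RL_integral_eq_conv:
  assumes "0 < \<beta>" "0 < t"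
  shows "RL_integral \<beta> u t = conv (rl_kernel \<beta>) u t"
proof -
  have "conv (rl_kernel \<beta>) u t = (LBINT s=0..t. (1 / Gamma \<beta>) *\<^sub>R ((t - s) powr (\<beta> - 1) *\<^sub>R u s))"
    using assms unfolding conv_eq_interval_integral[OF less_imp_le[OF assms(2)]]
    by (intro interval_integral_cong) (auto simp: rl_kernel_def rGamma_inverse_Gamma scaleR_conv_of_real divide_inverse)
  also have "\<dots> = (1 / Gamma \<beta>) *\<^sub>R (LBINT s=0..t. (t - s) powr (\<beta> - 1) *\<^sub>R u s)"
    
    by (simp only: interval_lebesgue_integral_def set_integral_scaleR_right scaleR_minus_right if_distrib[of "scaleR _"])
  finally show ?thesis
    using assms by (simp add: RL_integral_def)
qed

lemma RL_integral_exists_iff: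
  assumes "0 < \<beta>" "0 < t"
  shows "RL_integral_exists \<beta> u t \<longleftrightarrow> conv_exists (rl_kernel \<beta>) u t"
proof -
  have r: "rGamma \<beta> \<noteq> 0"
    using assms by (auto simp: rGamma_eq_zero_iff nonpos_Ints_def)
  have *: "rl_kernel \<beta> (t - s) * u s = rGamma \<beta> *\<^sub>R ((t - s) powr (\<beta> - 1) *\<^sub>R u s)" for s
    by (simp add: rl_kernel_def scaleR_conv_of_real)
  show ?thesis
    using assms r unfolding conv_exists_def RL_integral_exists_def * scaleR_conv_of_real[of "rGamma \<beta>"]
    by (subst set_integrable_mult_right_iff) (auto simp: interval_integrable_iff)
qed

lemma RL_integral_powr_cont:
  assumes "u \<in> powr_cont p T" "-1 < p" "0 \<le> \<beta>"
  shows "RL_integral \<beta> u \<in> powr_cont (p + \<beta>) T"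
proof (cases "\<beta> = 0")
  case False
  then have "conv (rl_kernel \<beta>) u \<in> powr_cont (\<beta> - 1 + p + 1) T"
    using assms by (intro powr_cont_conv rl_kernel_powr_cont) auto
  then have "RL_integral \<beta> u \<in> powr_cont (\<beta> - 1 + p + 1) T"
    by (rule powr_cont_cong) (use assms False in \<open>auto simp: RL_integral_eq_conv\<close>)
  then show ?thesis by (simp add: add.commute)
qed (use assms in \<open>auto simp: RL_integral_0\<close>)

lemma RL_integral_exists_powr_cont:
  assumes "u \<in> powr_cont p T" "-1 < p" "0 \<le> \<beta>" "0 < t" "t \<le> T"
  shows "RL_integral_exists \<beta> u t"
proof (cases "\<beta> = 0")
  case False
  then show ?thesis
    using assms by (auto simp: RL_integral_exists_iff intro!: powr_cont_conv_exists[OF rl_kernel_powr_cont])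
qed (auto simp: RL_integral_exists_def)

lemma RL_integral_cong:
  assumes "0 \<le> \<beta>" "0 < t" "\<And>s. 0 < s \<Longrightarrow> s \<le> t \<Longrightarrow> u s = v s"
  shows "RL_integral \<beta> u t = RL_integral \<beta> v t"
  using assms by (cases "\<beta> = 0") (auto simp: RL_integral_0 RL_integral_eq_conv intro!: conv_cong)

lemma RL_integral_linear:
  assumes "0 \<le> \<beta>" "0 < t" "RL_integral_exists \<beta> u t" "RL_integral_exists \<beta> v t"
  shows "RL_integral \<beta> (\<lambda>s. c * u s + d * v s) t = c * RL_integral \<beta> u t + d * RL_integral \<beta> v t"
    and "RL_integral_exists \<beta> (\<lambda>s. c * u s + d * v s) t"
proof -
  show "RL_integral \<beta> (\<lambda>s. c * u s + d * v s) t = c * RL_integral \<beta> u t + d * RL_integral \<beta> v t"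
    using assms
    by (cases "\<beta> = 0") (auto simp: RL_integral_0 RL_integral_eq_conv RL_integral_exists_iff conv_add_right conv_mult_right conv_exists_mult_right)
  show "RL_integral_exists \<beta> (\<lambda>s. c * u s + d * v s) t"
    using assms conv_exists_mult_right[of "rl_kernel \<beta>" u t c] conv_exists_mult_right[of "rl_kernel \<beta>" v t d]
    by (cases "\<beta> = 0") (auto simp: RL_integral_exists_def[of 0] RL_integral_exists_iff conv_exists_def distrib_left)
qed

section \<open>First, second and Riemann-Liouville derivatives\<close>

lemma has_1st_derivative_on_iff:
  "has_nth_derivative_on 1 u g S \<longleftrightarrow> (\<forall>t\<in>S. (u has_vector_derivative g t) (at t within S))"
proof -
  have "has_nth_derivative_on 1 u g S \<longleftrightarrow>
    (\<exists>v. (\<forall>t\<in>S. (u has_vector_derivative v t) (at t within S)) \<and> (\<forall>t\<in>S. g t = v t))"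
    by simp
  then show ?thesis by metis
qed

lemma has_2nd_derivative_on_iff:
  "has_nth_derivative_on 2 u g S \<longleftrightarrow>
    (\<exists>v. (\<forall>t\<in>S. (u has_vector_derivative v t) (at t within S)) \<and>
         (\<forall>t\<in>S. (v has_vector_derivative g t) (at t within S)))"
proof -
  have "has_nth_derivative_on 2 u g S \<longleftrightarrow> has_nth_derivative_on (Suc 1) u g S"
    by (simp only: Suc_1)
  also have "\<dots> \<longleftrightarrow> (\<exists>v. (\<forall>t\<in>S. (u has_vector_derivative v t) (at t within S)) \<and> has_nth_derivative_on 1 v g S)"
    by (simp only: has_nth_derivative_on.simps)
  finally show ?thesis
    by (simp only: has_1st_derivative_on_iff)
qed

text \<open>Taking n as the ceiling of \<alpha> unites the two cases of the definition: for an
  integer order the fractional integral has order 0, so it is the identity and exists trivially.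
  This lets \<alpha> = 2 and \<gamma> = 1 share the formulas of the fractional orders.\<close>

lemma has_RL_derivative_iff:
  assumes "real n - 1 < \<alpha>" "\<alpha> \<le> real n" "0 < n"
  shows "has_RL_derivative \<alpha> u g T \<longleftrightarrow>
    (\<forall>t\<in>{0<..<T}. RL_integral_exists (real n - \<alpha>) u t) \<and>
    has_nth_derivative_on n (RL_integral (real n - \<alpha>) u) g {0<..<T}"
proof (cases "\<alpha> = real n")
  case True
  then show ?thesis
    by (simp add: has_RL_derivative_def RL_integral_0 RL_integral_exists_def)
next
  case False
  then have f: "\<lfloor>\<alpha>\<rfloor> = int n - 1"
    using assms by (intro floor_unique) auto
  have "\<alpha> \<notin> \<int>"
  proof
    assume "\<alpha> \<in> \<int>"
    then have "of_int \<lfloor>\<alpha>\<rfloor> = \<alpha>" by (rule of_int_floor)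
    then show False using f assms by simp
  qed
  moreover have "nat \<lfloor>\<alpha>\<rfloor> + 1 = n" using f assms(3) by auto
  ultimately show ?thesis
    by (simp only: has_RL_derivative_def Let_def if_False)
qed

section \<open>Mittag-Leffler kernels\<close>

definition ml_kernel :: "real \<Rightarrow> real \<Rightarrow> real \<Rightarrow> real \<Rightarrow> complex" where
  "ml_kernel \<alpha> m b t = (t powr (b - 1)) *\<^sub>R mittag_leffler \<alpha> b (of_real (m * t powr \<alpha>))"

section \<open>Convergence of the Mittag-Leffler series\<close>

lemma rGamma_real_pos: "0 < x \<Longrightarrow> 0 < rGamma (x :: real)"
  by (simp add: rGamma_inverse_Gamma)

text \<open>Beta decreases in its first argument, so Beta \<alpha> x \<le> Beta 1 x = 1 / x for
  \<alpha> \<ge> 1. Consecutive Mittag-Leffler coefficients thus have a ratio of order 1 / x, which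
  tends to 0.\<close>

lemma rGamma_add_le:
  fixes x \<alpha> :: real
  assumes "0 < x" "1 \<le> \<alpha>"
  shows "rGamma (x + \<alpha>) \<le> rGamma x * (rGamma \<alpha> / x)"
proof -
  have G: "0 < Gamma x" "0 < Gamma \<alpha>" using assms by auto
  have "Beta \<alpha> x \<le> Beta 1 x"
    using assms by (intro Beta_real_mono) auto
  moreover have "Beta 1 x = 1 / x"
  proof -
    have "x * (Gamma x * rGamma (x + 1)) = Gamma x * rGamma x"
      using rGamma_plus1[of x] by (metis mult.left_commute)
    also have "\<dots> = 1"
      using G by (simp add: rGamma_inverse_Gamma del: Gamma_eq_zero_iff)
    finally show ?thesis
      using assms by (simp add: Beta_altdef field_simps)
  qed
  ultimately have "Gamma \<alpha> * Gamma x * rGamma (x + \<alpha>) \<le> 1 / x"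
    by (simp add: Beta_altdef add.commute)
  then have "rGamma \<alpha> * rGamma x * (Gamma \<alpha> * Gamma x * rGamma (x + \<alpha>)) \<le> rGamma \<alpha> * rGamma x * (1 / x)"
    using assms by (intro mult_left_mono) (auto intro!: mult_nonneg_nonneg less_imp_le[OF rGamma_real_pos])
  also have "rGamma \<alpha> * rGamma x * (Gamma \<alpha> * Gamma x * rGamma (x + \<alpha>)) =
      (rGamma \<alpha> * Gamma \<alpha>) * (rGamma x * Gamma x) * rGamma (x + \<alpha>)"
    by simp
  also have "\<dots> = rGamma (x + \<alpha>)"
    using G by (simp add: rGamma_inverse_Gamma[of \<alpha>] rGamma_inverse_Gamma[of x] del: Gamma_eq_zero_iff)
  finally show ?thesis by (simp add: mult.commute)
qed

lemma mittag_leffler_summable: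
  assumes "1 \<le> \<alpha>" "0 < b"
  shows "summable (\<lambda>k. rGamma (\<alpha> * real k + b) * r ^ k)"
proof -
  \<comment> \<open>From index N on, x \<ge> k \<ge> 2 * |r| * rGamma \<alpha>, which makes the
    ratio at most 1 / 2.\<close>
  define N where "N = nat \<lceil>2 * \<bar>r\<bar> * rGamma \<alpha>\<rceil>"
  have ra: "0 < rGamma \<alpha>" using assms by (intro rGamma_real_pos) auto
  show ?thesis
  proof (rule summable_ratio_test[of "1/2" N])
    fix k assume k: "N \<le> k"
    define x where "x = \<alpha> * real k + b"
    have "real k \<le> \<alpha> * real k" using assms by (simp add: mult_le_cancel_right1)
    then have x: "0 < x" "real k \<le> x" using assms unfolding x_def by linarith+
    have "2 * \<bar>r\<bar> * rGamma \<alpha> \<le> real N" unfolding N_def by linarith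
    then have "2 * \<bar>r\<bar> * rGamma \<alpha> \<le> x" using k x by linarith
    then have *: "\<bar>r\<bar> * (rGamma \<alpha> / x) \<le> 1 / 2" using x by (simp add: field_simps)
    have "norm (rGamma (\<alpha> * real (Suc k) + b) * r ^ Suc k) = rGamma (x + \<alpha>) * \<bar>r\<bar> ^ Suc k"
      using rGamma_real_pos[of "x + \<alpha>"] x assms
      by (simp add: x_def algebra_simps abs_mult power_abs)
    also have "\<dots> \<le> rGamma x * (rGamma \<alpha> / x) * \<bar>r\<bar> ^ Suc k"
      using x assms by (intro mult_right_mono rGamma_add_le) auto
    also have "\<dots> = (\<bar>r\<bar> * (rGamma \<alpha> / x)) * (rGamma x * \<bar>r\<bar> ^ k)"
      by simp
    also have "\<dots> \<le> 1 / 2 * (rGamma x * \<bar>r\<bar> ^ k)"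
      using * rGamma_real_pos[OF x(1)] by (intro mult_right_mono) auto
    also have "\<dots> = 1 / 2 * norm (rGamma (\<alpha> * real k + b) * r ^ k)"
      using rGamma_real_pos[OF x(1)] by (simp add: x_def[symmetric] abs_mult power_abs)
    finally show "norm (rGamma (\<alpha> * real (Suc k) + b) * r ^ Suc k) \<le> 1 / 2 * norm (rGamma (\<alpha> * real k + b) * r ^ k)" .
  qed simp
qed

lemma mittag_leffler_summable_norm:
  assumes "1 \<le> \<alpha>" "0 < b"
  shows "summable (\<lambda>k. norm (complex_of_real (rGamma (\<alpha> * real k + b)) * z ^ k))"
proof -
  have "rGamma (\<alpha> * real k + b) > 0" for k
    using assms by (intro rGamma_real_pos add_nonneg_pos) auto
  then have "norm (complex_of_real (rGamma (\<alpha> * real k + b)) * z ^ k) = rGamma (\<alpha> * real k + b) * norm z ^ k" for k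
    by (simp add: norm_mult norm_power less_imp_le)
  then show ?thesis
    using mittag_leffler_summable[OF assms] by simp
qed

lemma isCont_mittag_leffler:
  assumes "1 \<le> \<alpha>" "0 < b"
  shows "isCont (mittag_leffler \<alpha> b) z"
  unfolding mittag_leffler_def scaleR_conv_of_real
  by (rule isCont_powser_converges_everywhere) (rule summable_norm_cancel[OF mittag_leffler_summable_norm[OF assms]])

lemma mittag_leffler_0: "mittag_leffler \<alpha> b 0 = of_real (rGamma b)"
  unfolding mittag_leffler_def scaleR_conv_of_real by (simp add: powser_zero)

lemma continuous_on_mittag_leffler_powr:
  assumes "1 \<le> \<alpha>" "0 < b"
  shows "continuous_on {0..T} (\<lambda>t. mittag_leffler \<alpha> b (of_real (m * t powr \<alpha>)))"
proof -
  have "continuous_on UNIV (mittag_leffler \<alpha> b)"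
    using isCont_mittag_leffler[OF assms] by (auto simp: continuous_on_eq_continuous_at)
  then show ?thesis
    by (rule continuous_on_compose2) (use assms in \<open>auto intro!: continuous_intros continuous_on_powr'\<close>)
qed

lemma ml_kernel_powr_cont:
  assumes "1 \<le> \<alpha>" "0 < b"
  shows "ml_kernel \<alpha> m b \<in> powr_cont (b - 1) T"
  by (rule powr_contI[OF continuous_on_mittag_leffler_powr[OF assms]]) (simp add: ml_kernel_def)

text \<open>Only the term k = 0 survives at the origin. The factor c leaves room for the normalising
  Gamma value of the first initial condition.\<close>

lemma ml_kernel_tendsto:
  assumes "1 \<le> \<alpha>" "0 < b"
  shows "((\<lambda>t. (c * t powr (1 - b)) *\<^sub>R ml_kernel \<alpha> m b t) \<longlongrightarrow> of_real (c * rGamma b)) (at_right 0)"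
proof -
  have "((\<lambda>t. mittag_leffler \<alpha> b (of_real (m * t powr \<alpha>))) \<longlongrightarrow> mittag_leffler \<alpha> b (of_real (m * 0 powr \<alpha>))) (at_right 0)"
    using continuous_on_mittag_leffler_powr[OF assms, of 1 m]
    by (auto simp: continuous_on_def at_within_Icc_at_right dest!: bspec[of _ _ 0])
  then have "((\<lambda>t. c *\<^sub>R mittag_leffler \<alpha> b (of_real (m * t powr \<alpha>))) \<longlongrightarrow> c *\<^sub>R of_real (rGamma b)) (at_right 0)"
    by (intro tendsto_intros) (simp add: mittag_leffler_0)
  moreover have "eventually (\<lambda>t. c *\<^sub>R mittag_leffler \<alpha> b (of_real (m * t powr \<alpha>))
      = (c * t powr (1 - b)) *\<^sub>R ml_kernel \<alpha> m b t) (at_right 0)"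
    using eventually_at_right_real[of 0 1, OF zero_less_one]
    by eventually_elim (simp add: ml_kernel_def powr_add[symmetric])
  ultimately show ?thesis
    unfolding of_real_mult scaleR_conv_of_real[of c "of_real (rGamma b)"] by (rule Lim_transform_eventually)
qed

text \<open>Recasts the power series as a series of fractional kernels, so that identities for
  \<open>rl_kernel\<close> transfer to \<open>ml_kernel\<close> term by term.\<close>

lemma ml_kernel_term:
  assumes "0 < t"
  shows "of_real m ^ k * rl_kernel (\<alpha> * real k + b) t
     = (t powr (b - 1)) *\<^sub>R (of_real (rGamma (\<alpha> * real k + b)) * of_real (m * t powr \<alpha>) ^ k)"
proof -
  have "t powr (\<alpha> * real k + b - 1) = t powr (b - 1) * (t powr \<alpha>) ^ k"
    using assms by (simp add: powr_power powr_add[symmetric] algebra_simps)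
  then show ?thesis
    by (simp add: rl_kernel_def scaleR_conv_of_real power_mult_distrib)
qed

lemma
  assumes "1 \<le> \<alpha>" "0 < b" "0 < t"
  shows ml_kernel_summable_norm: "summable (\<lambda>k. norm (of_real m ^ k * rl_kernel (\<alpha> * real k + b) t))"
    and ml_kernel_sums: "(\<lambda>k. of_real m ^ k * rl_kernel (\<alpha> * real k + b) t) sums ml_kernel \<alpha> m b t"
proof -
  note s = mittag_leffler_summable_norm[OF assms(1,2), of "of_real (m * t powr \<alpha>)"]
  show "summable (\<lambda>k. norm (of_real m ^ k * rl_kernel (\<alpha> * real k + b) t))"
    unfolding ml_kernel_term[OF assms(3)] norm_scaleR by (intro summable_mult s)
  show "(\<lambda>k. of_real m ^ k * rl_kernel (\<alpha> * real k + b) t) sums ml_kernel \<alpha> m b t"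
    unfolding ml_kernel_term[OF assms(3)] ml_kernel_def mittag_leffler_def scaleR_conv_of_real[of "rGamma _"]
    by (intro sums_scaleR_right summable_sums summable_norm_cancel[OF s])
qed

lemma ml_kernel_unfold:
  assumes "1 \<le> \<alpha>" "0 < b" "0 < t"
  shows "ml_kernel \<alpha> m b t = rl_kernel b t + of_real m * ml_kernel \<alpha> m (b + \<alpha>) t"
proof -
  have "(\<lambda>k. of_real m ^ Suc k * rl_kernel (\<alpha> * real (Suc k) + b) t) sums (of_real m * ml_kernel \<alpha> m (b + \<alpha>) t)"
    using sums_mult[OF ml_kernel_sums[of \<alpha> "b + \<alpha>" t m], of "of_real m"] assms
    by (simp add: algebra_simps)
  then have "(\<lambda>k. of_real m ^ k * rl_kernel (\<alpha> * real k + b) t) sums (of_real m * ml_kernel \<alpha> m (b + \<alpha>) t + rl_kernel b t)"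
    by (subst (asm) sums_Suc_iff) simp
  then show ?thesis
    using ml_kernel_sums[OF assms] by (metis sums_unique2 add.commute)
qed

lemma rl_kernel_norm: "0 < b \<Longrightarrow> of_real (norm (rl_kernel b s)) = rl_kernel b s"
  using rGamma_real_pos[of b] by (simp add: rl_kernel_def norm_mult)

text \<open>Sum and integral are exchanged by summability of the L1 norms: the kernels are
  nonnegative, so the L1 norm of the k-th term is the modulus of the k-th term of the resulting
  series, which converges absolutely.\<close>

lemma conv_rl_kernel_ml_kernel:
  assumes "1 \<le> \<alpha>" "0 < b" "0 < c" "0 < t"
  shows "conv (rl_kernel c) (ml_kernel \<alpha> m b) t = ml_kernel \<alpha> m (b + c) t"
proof -
  define f where "f = (\<lambda>k s. indicator {0<..<t} s *\<^sub>R (rl_kernel c (t - s) * (of_real m ^ k * rl_kernel (\<alpha> * real k + b) s)))"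
  have pos: "0 < \<alpha> * real k + b" for k
    using assms by (intro add_nonneg_pos) auto
  have ex: "conv_exists (rl_kernel c) (rl_kernel (\<alpha> * real k + b)) t" for k
    using assms pos by (intro powr_cont_conv_exists[OF rl_kernel_powr_cont rl_kernel_powr_cont]) auto
  have f_int: "integrable lborel (f k)" for k
    using conv_exists_mult_right[OF ex] unfolding f_def conv_exists_def set_integrable_def .
  have f_val: "(\<integral>s. f k s \<partial>lborel) = of_real m ^ k * rl_kernel (\<alpha> * real k + (b + c)) t" for k
  proof -
    have "(\<integral>s. f k s \<partial>lborel) = conv (rl_kernel c) (\<lambda>s. of_real m ^ k * rl_kernel (\<alpha> * real k + b) s) t"
      by (simp add: f_def conv_def set_lebesgue_integral_def)
    then show ?thesis
      unfolding conv_mult_right conv_rl_kernel[OF assms(3) pos assms(4)] by (simp add: algebra_simps)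
  qed
  have f_norm: "(\<integral>s. norm (f k s) \<partial>lborel) = norm (of_real m ^ k * rl_kernel (\<alpha> * real k + (b + c)) t)" for k
  proof -
    let ?g = "rl_kernel (\<alpha> * real k + b)"
    have "(\<integral>s. norm (f k s) \<partial>lborel) = (\<integral>s. \<bar>m\<bar> ^ k * (indicator {0<..<t} s *\<^sub>R norm (rl_kernel c (t - s) * ?g s)) \<partial>lborel)"
      by (intro Bochner_Integration.integral_cong) (auto simp: f_def norm_mult norm_power)
    also have "\<dots> = \<bar>m\<bar> ^ k * (LINT s:{0<..<t}|lborel. norm (rl_kernel c (t - s) * ?g s))"
      unfolding set_lebesgue_integral_def by (rule integral_mult_right_zero)
    also have "complex_of_real (LINT s:{0<..<t}|lborel. norm (rl_kernel c (t - s) * ?g s))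
        = rl_kernel (c + (\<alpha> * real k + b)) t"
      unfolding conv_norm_eq[symmetric] using assms pos by (simp add: rl_kernel_norm conv_rl_kernel)
    then have "(LINT s:{0<..<t}|lborel. norm (rl_kernel c (t - s) * ?g s)) = Re (rl_kernel (c + (\<alpha> * real k + b)) t)"
      by (metis Re_complex_of_real)
    also have "\<dots> = norm (rl_kernel (c + (\<alpha> * real k + b)) t)"
      using assms pos by (metis Re_complex_of_real rl_kernel_norm add_pos_pos)
    finally show ?thesis
      by (simp add: norm_mult norm_power algebra_simps)
  qed
  have "conv (rl_kernel c) (ml_kernel \<alpha> m b) t = (\<integral>s. (\<Sum>k. f k s) \<partial>lborel)"
    unfolding conv_def set_lebesgue_integral_def
  proof (rule Bochner_Integration.integral_cong[OF refl])
    fix s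
    show "indicator {0<..<t} s *\<^sub>R (rl_kernel c (t - s) * ml_kernel \<alpha> m b s) = (\<Sum>k. f k s)"
    proof (cases "s \<in> {0<..<t}")
      case True
      then have "(\<lambda>k. rl_kernel c (t - s) * (of_real m ^ k * rl_kernel (\<alpha> * real k + b) s)) sums (rl_kernel c (t - s) * ml_kernel \<alpha> m b s)"
        using assms by (intro sums_mult ml_kernel_sums) auto
      then show ?thesis
        using True by (simp add: f_def sums_unique)
    qed (simp add: f_def)
  qed
  also have "\<dots> = (\<Sum>k. \<integral>s. f k s \<partial>lborel)"
  proof (rule integral_suminf)
    show "AE s in lborel. summable (\<lambda>k. norm (f k s))"
    proof (rule AE_I2)
      fix s
      show "summable (\<lambda>k. norm (f k s))"
      proof (cases "s \<in> {0<..<t}")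
        case True
        then have "summable (\<lambda>k. norm (rl_kernel c (t - s)) * norm (of_real m ^ k * rl_kernel (\<alpha> * real k + b) s))"
          using assms by (intro summable_mult ml_kernel_summable_norm) auto
        then show ?thesis
          using True by (simp add: f_def norm_mult)
      qed (simp add: f_def)
    qed
    show "summable (\<lambda>k. \<integral>s. norm (f k s) \<partial>lborel)"
      unfolding f_norm using assms by (intro ml_kernel_summable_norm) auto
  qed (use f_int in auto)
  also have "\<dots> = ml_kernel \<alpha> m (b + c) t"
    unfolding f_val using ml_kernel_sums[of \<alpha> "b + c" t m] assms by (simp add: sums_unique[symmetric])
  finally show ?thesis .
qed

section \<open>Fractional integrals and derivatives of the Mittag-Leffler kernels\<close>

lemma RL_integral_ml_kernel:
  assumes "1 \<le> \<alpha>" "0 < b" "0 \<le> \<beta>" "0 < t"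
  shows "RL_integral \<beta> (ml_kernel \<alpha> m b) t = ml_kernel \<alpha> m (b + \<beta>) t"
  using assms
  by (cases "\<beta> = 0") (auto simp: RL_integral_0 RL_integral_eq_conv conv_rl_kernel_ml_kernel)

lemma RL_integral_conv_ml_kernel:
  assumes f: "f \<in> powr_cont p T" "-1 < p" and "1 \<le> \<alpha>" "0 < b" "0 \<le> \<beta>" and t: "0 < t" "t \<le> T"
  shows "RL_integral \<beta> (conv f (ml_kernel \<alpha> m b)) t = conv f (ml_kernel \<alpha> m (b + \<beta>)) t"
proof (cases "\<beta> = 0")
  case False
  then have "RL_integral \<beta> (conv f (ml_kernel \<alpha> m b)) t = conv f (conv (rl_kernel \<beta>) (ml_kernel \<alpha> m b)) t"
    using assms RL_integral_eq_conv
      powr_cont_conv_commute_assoc[OF rl_kernel_powr_cont f(1) ml_kernel_powr_cont, of \<alpha> b \<beta> t m]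
    by simp
  also have "\<dots> = conv f (ml_kernel \<alpha> m (b + \<beta>)) t"
    using assms False by (intro conv_cong refl conv_rl_kernel_ml_kernel) auto
  finally show ?thesis .
qed (simp add: RL_integral_0)

text \<open>G(b + 1) = g(1) * G(b) is a primitive of G(b), which replaces a termwise differentiation
  of the series.\<close>

lemma ml_kernel_has_derivative:
  assumes "1 \<le> \<alpha>" "0 < b" and t: "0 < t" "t \<le> T"
  shows "(ml_kernel \<alpha> m (b + 1) has_vector_derivative ml_kernel \<alpha> m b t) (at t within {0<..T})"
  using powr_cont_conv_1_has_derivative[OF ml_kernel_powr_cont, of \<alpha> b t T m]
  by (rule has_vector_derivative_transform[rotated 2])
     (use assms in \<open>auto simp: conv_rl_kernel_ml_kernel\<close>)

lemma conv_ml_kernel_has_derivative: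
  assumes f: "f \<in> powr_cont p T" "-1 < p" and "1 \<le> \<alpha>" "0 < b" and t: "0 < t" "t \<le> T"
  shows "(conv f (ml_kernel \<alpha> m (b + 1)) has_vector_derivative conv f (ml_kernel \<alpha> m b) t) (at t within {0<..T})"
proof (rule has_vector_derivative_transform)
  show "(conv (rl_kernel 1) (conv f (ml_kernel \<alpha> m b)) has_vector_derivative conv f (ml_kernel \<alpha> m b) t) (at t within {0<..T})"
    using assms by (intro powr_cont_conv_1_has_derivative[OF powr_cont_conv[OF f(1) ml_kernel_powr_cont]]) auto
  show "conv f (ml_kernel \<alpha> m (b + 1)) x = conv (rl_kernel 1) (conv f (ml_kernel \<alpha> m b)) x" if "x \<in> {0<..T}" for x
    using assms that RL_integral_conv_ml_kernel[OF f, of \<alpha> b 1 x m] by (simp add: RL_integral_eq_conv)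
qed (use t in auto)

text \<open>Lowering the index 1 would lead to index 0, outside the range of the kernel lemmas.
  Unfolding first splits off the constant g(1) = 1; this agrees with the convention 1 / Gamma 0 = 0,
  under which G(0) = m G(\<alpha>).\<close>

lemma ml_kernel_1_has_derivative:
  assumes "1 \<le> \<alpha>" and t: "0 < t" "t \<le> T"
  shows "(ml_kernel \<alpha> m 1 has_vector_derivative of_real m * ml_kernel \<alpha> m \<alpha> t) (at t within {0<..T})"
proof (rule has_vector_derivative_transform)
  have "((\<lambda>x. 1 + of_real m * ml_kernel \<alpha> m (\<alpha> + 1) x) has_vector_derivative 0 + of_real m * ml_kernel \<alpha> m \<alpha> t) (at t within {0<..T})"
    using assms by (intro has_vector_derivative_add has_vector_derivative_const has_vector_derivative_mult_right ml_kernel_has_derivative) auto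
  then show "((\<lambda>x. 1 + of_real m * ml_kernel \<alpha> m (\<alpha> + 1) x) has_vector_derivative of_real m * ml_kernel \<alpha> m \<alpha> t) (at t within {0<..T})"
    by simp
  show "ml_kernel \<alpha> m 1 x = 1 + of_real m * ml_kernel \<alpha> m (\<alpha> + 1) x" if "x \<in> {0<..T}" for x
    using that assms ml_kernel_unfold[of \<alpha> 1 x m] by (simp add: rl_kernel_1 add.commute)
qed (use t in auto)

text \<open>The source term of the equation appears here: the constant split off from G(1)
  contributes I(1) f, whose derivative is f.\<close>

lemma conv_ml_kernel_1_has_derivative:
  assumes f: "f \<in> powr_cont p T" "-1 < p" and "1 \<le> \<alpha>" and t: "0 < t" "t \<le> T"
  shows "(conv f (ml_kernel \<alpha> m 1) has_vector_derivative f t + of_real m * conv f (ml_kernel \<alpha> m \<alpha>) t) (at t within {0<..T})"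
proof (rule has_vector_derivative_transform)
  show "((\<lambda>x. conv (rl_kernel 1) f x + of_real m * conv f (ml_kernel \<alpha> m (\<alpha> + 1)) x) has_vector_derivative
      f t + of_real m * conv f (ml_kernel \<alpha> m \<alpha>) t) (at t within {0<..T})"
    using assms by (intro has_vector_derivative_add has_vector_derivative_mult_right
        powr_cont_conv_1_has_derivative[OF f] conv_ml_kernel_has_derivative[OF f]) auto
  show "conv f (ml_kernel \<alpha> m 1) x = conv (rl_kernel 1) f x + of_real m * conv f (ml_kernel \<alpha> m (\<alpha> + 1)) x"
    if x: "x \<in> {0<..T}" for x
  proof -
    have "conv f (ml_kernel \<alpha> m 1) x = conv f (\<lambda>s. rl_kernel 1 s + of_real m * ml_kernel \<alpha> m (\<alpha> + 1) s) x"
      using assms ml_kernel_unfold[of \<alpha> 1 _ m] by (intro conv_cong) (auto simp: add.commute)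
    also have "\<dots> = conv f (rl_kernel 1) x + of_real m * conv f (ml_kernel \<alpha> m (\<alpha> + 1)) x"
      using assms x powr_cont_conv_exists[OF f(1) rl_kernel_powr_cont[of 1], of x]
        powr_cont_conv_exists[OF f(1) ml_kernel_powr_cont[of \<alpha> "\<alpha> + 1"], of x]
      by (simp add: conv_add_right conv_exists_mult_right conv_mult_right)
    finally show ?thesis
      by (simp add: conv_commute)
  qed
qed (use t in auto)

section \<open>Existence\<close>

lemma has_nth_derivative_on_cong:
  assumes "\<And>t. t \<in> S \<Longrightarrow> u t = v t" "\<And>t. t \<in> S \<Longrightarrow> g t = h t"
  shows "has_nth_derivative_on n u g S \<longleftrightarrow> has_nth_derivative_on n v h S"
proof -
  have *: "has_nth_derivative_on n u g S \<Longrightarrow> has_nth_derivative_on n v h S"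
    if "\<And>t. t \<in> S \<Longrightarrow> u t = v t" "\<And>t. t \<in> S \<Longrightarrow> g t = h t" for n u v g h
    using that
  proof (induction n arbitrary: u v)
    case (Suc n)
    then obtain w where w: "\<forall>t\<in>S. (u has_vector_derivative w t) (at t within S)" "has_nth_derivative_on n w g S"
      by auto
    have "(v has_vector_derivative w t) (at t within S)" if "t \<in> S" for t
      by (rule has_vector_derivative_transform[OF that _ w(1)[rule_format, OF that]]) (simp add: Suc.prems)
    moreover have "has_nth_derivative_on n w h S"
      by (rule Suc.IH[OF w(2)]) (auto simp: Suc.prems)
    ultimately show ?case by auto
  qed simp
  show ?thesis
    using *[of u v g h n] *[of v u h g n] assms by auto
qed

lemma has_nth_derivative_on_linear:
  assumes "has_nth_derivative_on n u g S" "has_nth_derivative_on n v h S"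
  shows "has_nth_derivative_on n (\<lambda>t. c * u t + d * v t) (\<lambda>t. c * g t + d * h t) S"
  using assms
proof (induction n arbitrary: u v)
  case (Suc n)
  from Suc.prems obtain u' where u': "\<forall>t\<in>S. (u has_vector_derivative u' t) (at t within S)" "has_nth_derivative_on n u' g S"
    by auto
  from Suc.prems obtain v' where v': "\<forall>t\<in>S. (v has_vector_derivative v' t) (at t within S)" "has_nth_derivative_on n v' h S"
    by auto
  show ?case
    unfolding has_nth_derivative_on.simps
    by (rule exI[of _ "\<lambda>t. c * u' t + d * v' t"])
       (auto intro!: Suc.IH u'(2) v'(2) has_vector_derivative_add has_vector_derivative_mult_right u'(1)[rule_format] v'(1)[rule_format])
qed simp

lemma has_RL_derivative_linear:
  assumes "0 < \<alpha>" "has_RL_derivative \<alpha> u g T" "has_RL_derivative \<alpha> v h T"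
  shows "has_RL_derivative \<alpha> (\<lambda>t. c * u t + d * v t) (\<lambda>t. c * g t + d * h t) T"
proof -
  define n where "n = nat \<lceil>\<alpha>\<rceil>"
  have n: "real n - 1 < \<alpha>" "\<alpha> \<le> real n" "0 < n"
    using assms(1) unfolding n_def by linarith+
  note iff = has_RL_derivative_iff[OF n]
  have "has_nth_derivative_on n (RL_integral (real n - \<alpha>) (\<lambda>t. c * u t + d * v t)) (\<lambda>t. c * g t + d * h t) {0<..<T} \<longleftrightarrow>
    has_nth_derivative_on n (\<lambda>t. c * RL_integral (real n - \<alpha>) u t + d * RL_integral (real n - \<alpha>) v t) (\<lambda>t. c * g t + d * h t) {0<..<T}"
    using assms n unfolding iff by (intro has_nth_derivative_on_cong refl RL_integral_linear) auto
  then show ?thesis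
    using assms n unfolding iff by (auto intro!: has_nth_derivative_on_linear RL_integral_linear)
qed

lemma RL_integral_exists_cong:
  assumes "0 \<le> \<beta>" "0 < t" "\<And>s. 0 < s \<Longrightarrow> s < t \<Longrightarrow> u s = v s"
  shows "RL_integral_exists \<beta> u t \<longleftrightarrow> RL_integral_exists \<beta> v t"
proof (cases "\<beta> = 0")
  case False
  then show ?thesis
    using assms by (simp add: RL_integral_exists_iff cong: conv_exists_cong)
qed (simp add: RL_integral_exists_def)

lemma has_RL_derivative_cong:
  assumes "0 < \<alpha>" "\<And>t. 0 < t \<Longrightarrow> t < T \<Longrightarrow> u t = v t" "has_RL_derivative \<alpha> u g T"
  shows "has_RL_derivative \<alpha> v g T"
proof -
  define n where "n = nat \<lceil>\<alpha>\<rceil>"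
  have n: "real n - 1 < \<alpha>" "\<alpha> \<le> real n" "0 < n"
    using assms(1) unfolding n_def by linarith+
  note iff = has_RL_derivative_iff[OF n]
  have "RL_integral_exists (real n - \<alpha>) u t \<longleftrightarrow> RL_integral_exists (real n - \<alpha>) v t" if "t \<in> {0<..<T}" for t
    using that n assms(2) by (intro RL_integral_exists_cong) auto
  moreover have "has_nth_derivative_on n (RL_integral (real n - \<alpha>) u) g {0<..<T} \<longleftrightarrow>
     has_nth_derivative_on n (RL_integral (real n - \<alpha>) v) g {0<..<T}"
    using n assms(2) by (intro has_nth_derivative_on_cong refl RL_integral_cong) auto
  ultimately show ?thesis
    using assms(3) unfolding iff by auto
qed

lemma solves_equation_linear:
  assumes "0 < \<alpha>" "solves_equation T \<alpha> m f u" "solves_equation T \<alpha> m k v"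
  shows "solves_equation T \<alpha> m (\<lambda>t. c * f t + d * k t) (\<lambda>t. c * u t + d * v t)"
proof -
  obtain g where g: "has_RL_derivative \<alpha> u g T" "\<And>t. t\<in>{0<..<T} \<Longrightarrow> g t - of_real m * u t = f t"
    using assms(2) unfolding solves_equation_def by blast
  obtain h where h: "has_RL_derivative \<alpha> v h T" "\<And>t. t\<in>{0<..<T} \<Longrightarrow> h t - of_real m * v t = k t"
    using assms(3) unfolding solves_equation_def by blast
  show ?thesis
    unfolding solves_equation_def
    by (rule exI[of _ "\<lambda>t. c * g t + d * h t"])
       (auto intro!: has_RL_derivative_linear assms(1) g(1) h(1) simp: g(2)[symmetric] h(2)[symmetric] algebra_simps)
qed

lemma initial_condition1_linear:
  assumes "0 < T" "0 \<le> \<beta>" "initial_condition1 T \<alpha> \<beta> u a" "initial_condition1 T \<alpha> \<beta> v b"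
  shows "initial_condition1 T \<alpha> \<beta> (\<lambda>t. c * u t + d * v t) (c * a + d * b)"
proof -
  let ?s = "\<lambda>t. Gamma (\<alpha> + \<beta> - 1) * t powr (2 - \<alpha> - \<beta>)"
  have "((\<lambda>t. c * (?s t *\<^sub>R RL_integral \<beta> u t) + d * (?s t *\<^sub>R RL_integral \<beta> v t)) \<longlongrightarrow> c * a + d * b) (at_right 0)"
    using assms unfolding initial_condition1_def by (intro tendsto_intros) auto
  moreover have "eventually (\<lambda>t. c * (?s t *\<^sub>R RL_integral \<beta> u t) + d * (?s t *\<^sub>R RL_integral \<beta> v t)
       = ?s t *\<^sub>R RL_integral \<beta> (\<lambda>t. c * u t + d * v t) t) (at_right 0)"
    using eventually_at_right_real[OF assms(1)]
  proof eventually_elim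
    case (elim t)
    then show ?case
      using assms by (subst RL_integral_linear(1)) (auto simp: initial_condition1_def algebra_simps)
  qed
  ultimately show ?thesis
    using assms unfolding initial_condition1_def
    by (auto intro!: RL_integral_linear(2) elim: Lim_transform_eventually)
qed

lemma initial_condition2_linear:
  assumes "0 < \<gamma>" "initial_condition2 T \<gamma> u a" "initial_condition2 T \<gamma> v b"
  shows "initial_condition2 T \<gamma> (\<lambda>t. c * u t + d * v t) (c * a + d * b)"
proof -
  obtain g where g: "has_RL_derivative \<gamma> u g T" "(g \<longlongrightarrow> a) (at_right 0)"
    using assms(2) unfolding initial_condition2_def by blast
  obtain h where h: "has_RL_derivative \<gamma> v h T" "(h \<longlongrightarrow> b) (at_right 0)"
    using assms(3) unfolding initial_condition2_def by blast
  show ?thesis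
    unfolding initial_condition2_def
    by (rule exI[of _ "\<lambda>t. c * g t + d * h t"])
       (auto intro!: has_RL_derivative_linear assms(1) g h tendsto_intros)
qed

lemma solves_problem_diff:
  assumes "0 < T" "0 < \<alpha>" "0 \<le> \<beta>" "0 < \<gamma>"
    and "solves_problem T \<alpha> \<beta> \<gamma> m f c1 c2 u" "solves_problem T \<alpha> \<beta> \<gamma> m f c1 c2 v"
  shows "solves_problem T \<alpha> \<beta> \<gamma> m (\<lambda>_. 0) 0 0 (\<lambda>t. u t - v t)"
  using assms solves_equation_linear[of \<alpha> T m f u f v 1 "-1"]
    initial_condition1_linear[of T \<beta> \<alpha> u "of_real c1" v "of_real c1" 1 "-1"]
    initial_condition2_linear[of \<gamma> T u "of_real c2" v "of_real c2" 1 "-1"]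
  unfolding solves_problem_def by simp

text \<open>Serves to pass from \<open>conv\<close> to the interval integral of the theorem, since
  the two are equated only for nonnegative t.\<close>

lemma solves_problem_cong:
  assumes "0 < T" "0 < \<alpha>" "0 \<le> \<beta>" "0 < \<gamma>" and uv: "\<And>t. 0 < t \<Longrightarrow> t < T \<Longrightarrow> u t = v t"
    and u: "solves_problem T \<alpha> \<beta> \<gamma> m f c1 c2 u"
  shows "solves_problem T \<alpha> \<beta> \<gamma> m f c1 c2 v"
proof -
  have "solves_equation T \<alpha> m f v"
  proof -
    obtain g where "has_RL_derivative \<alpha> u g T" "\<And>t. t \<in> {0<..<T} \<Longrightarrow> g t - of_real m * u t = f t"
      using u unfolding solves_problem_def solves_equation_def by blast
    then show ?thesis
      using has_RL_derivative_cong[where u = u and v = v and T = T, OF assms(2) uv] uv unfolding solves_equation_def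
      by (intro exI[of _ g]) auto
  qed
  moreover have "initial_condition2 T \<gamma> v (of_real c2)"
    using u has_RL_derivative_cong[where u = u and v = v and T = T, OF assms(4) uv] unfolding solves_problem_def initial_condition2_def by blast
  moreover have "initial_condition1 T \<alpha> \<beta> v (of_real c1)"
  proof -
    have ic: "initial_condition1 T \<alpha> \<beta> u (of_real c1)"
      using u by (simp add: solves_problem_def)
    have "eventually (\<lambda>t. (Gamma (\<alpha> + \<beta> - 1) * t powr (2 - \<alpha> - \<beta>)) *\<^sub>R RL_integral \<beta> u t
        = (Gamma (\<alpha> + \<beta> - 1) * t powr (2 - \<alpha> - \<beta>)) *\<^sub>R RL_integral \<beta> v t) (at_right 0)"
      using eventually_at_right_real[OF assms(1)]
      by eventually_elim (use uv assms(3) RL_integral_cong[of \<beta> _ u v] in auto)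
    moreover have "RL_integral_exists \<beta> u t \<longleftrightarrow> RL_integral_exists \<beta> v t" if "t \<in> {0<..<T}" for t
      using that uv assms(3) by (intro RL_integral_exists_cong) auto
    ultimately show ?thesis
      using ic unfolding initial_condition1_def by (auto elim: Lim_transform_eventually)
  qed
  ultimately show ?thesis
    by (simp add: solves_problem_def)
qed

lemma at_within_Ioo_of_Ioc:
  "(f has_vector_derivative d) (at t within {0<..T}) \<Longrightarrow> (f has_vector_derivative d) (at t within {0<..<T :: real})"
  by (rule has_vector_derivative_within_subset) auto

section \<open>Solutions built from Mittag-Leffler kernels\<close>

lemma has_RL_derivative_1I:
  assumes "0 < \<gamma>" "\<gamma> \<le> 1" and u: "u \<in> powr_cont p T" "-1 < p"
    and "\<And>t. 0 < t \<Longrightarrow> t \<le> T \<Longrightarrow> RL_integral (1 - \<gamma>) u t = W t"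
    and "\<And>t. 0 < t \<Longrightarrow> t \<le> T \<Longrightarrow> (W has_vector_derivative g t) (at t within {0<..T})"
  shows "has_RL_derivative \<gamma> u g T"
proof -
  have "has_nth_derivative_on 1 (RL_integral (1 - \<gamma>) u) g {0<..<T} \<longleftrightarrow> has_nth_derivative_on 1 W g {0<..<T}"
    using assms by (intro has_nth_derivative_on_cong) auto
  moreover have "has_nth_derivative_on 1 W g {0<..<T}"
    unfolding has_1st_derivative_on_iff using assms by (auto intro!: at_within_Ioo_of_Ioc)
  ultimately show ?thesis
    using assms has_RL_derivative_iff[of 1 \<gamma> u g T]
    by (auto intro!: RL_integral_exists_powr_cont[OF u])
qed

text \<open>The derivative chain is taken on (0, T], the form shared with the C^2_{-1} regularity
  claims; restriction to the open interval makes the derivatives two-sided.\<close>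

lemma has_RL_derivative_2I:
  assumes "1 < \<alpha>" "\<alpha> \<le> 2" and u: "u \<in> powr_cont p T" "-1 < p"
    and "\<And>t. 0 < t \<Longrightarrow> t \<le> T \<Longrightarrow> RL_integral (2 - \<alpha>) u t = W t"
    and "\<And>t. 0 < t \<Longrightarrow> t \<le> T \<Longrightarrow> (W has_vector_derivative W' t) (at t within {0<..T})"
    and "\<And>t. 0 < t \<Longrightarrow> t \<le> T \<Longrightarrow> (W' has_vector_derivative g t) (at t within {0<..T})"
  shows "has_RL_derivative \<alpha> u g T"
proof -
  have "has_nth_derivative_on 2 (RL_integral (2 - \<alpha>) u) g {0<..<T} \<longleftrightarrow> has_nth_derivative_on 2 W g {0<..<T}"
    using assms by (intro has_nth_derivative_on_cong) auto
  moreover have "has_nth_derivative_on 2 W g {0<..<T}"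
    unfolding has_2nd_derivative_on_iff
    using assms by (intro exI[of _ W']) (auto intro!: at_within_Ioo_of_Ioc)
  ultimately show ?thesis
    using assms has_RL_derivative_iff[of 2 \<alpha> u g T]
    by (auto intro!: RL_integral_exists_powr_cont[OF u])
qed

text \<open>Power count: I(\<beta>) raises the exponent p by \<beta>, and the weight brings it to p
  + 2 - \<alpha>, which is positive.\<close>

lemma initial_condition1_0I:
  assumes "0 < T" "0 \<le> \<beta>" "\<alpha> - 2 < p" "-1 < p" "u \<in> powr_cont p T"
  shows "initial_condition1 T \<alpha> \<beta> u 0"
proof -
  have "(\<lambda>t. (Gamma (\<alpha> + \<beta> - 1) * t powr (2 - \<alpha> - \<beta>)) *\<^sub>R RL_integral \<beta> u t) \<in> powr_cont (p + \<beta> + (2 - \<alpha> - \<beta>)) T"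
    using assms by (intro powr_cont_powr_scaleR RL_integral_powr_cont) auto
  then show ?thesis
    unfolding initial_condition1_def
    using assms by (auto intro!: powr_cont_tendsto_0 RL_integral_exists_powr_cont)
qed

text \<open>I(\<beta>) raises the index to \<alpha> + \<beta> - 1, and the weight with its Gamma
  factor is the reciprocal of the leading term of that kernel at 0.\<close>

lemma ml_kernel_IC1:
  assumes "0 < T" "1 < \<alpha>" "0 \<le> \<beta>"
  shows "initial_condition1 T \<alpha> \<beta> (ml_kernel \<alpha> m (\<alpha> - 1)) 1"
proof -
  let ?c = "\<alpha> + \<beta> - 1"
  have "Gamma ?c * rGamma ?c = 1"
    unfolding rGamma_inverse_Gamma
    by (rule right_inverse) (use Gamma_real_pos[of ?c] assms in linarith)
  moreover have "((\<lambda>t. (Gamma ?c * t powr (1 - ?c)) *\<^sub>R ml_kernel \<alpha> m ?c t)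
      \<longlongrightarrow> of_real (Gamma ?c * rGamma ?c)) (at_right 0)"
    using assms by (intro ml_kernel_tendsto) auto
  ultimately have lim: "((\<lambda>t. (Gamma ?c * t powr (1 - ?c)) *\<^sub>R ml_kernel \<alpha> m ?c t) \<longlongrightarrow> 1) (at_right 0)"
    by simp
  have ev: "eventually (\<lambda>t. (Gamma ?c * t powr (1 - ?c)) *\<^sub>R ml_kernel \<alpha> m ?c t =
     (Gamma ?c * t powr (2 - \<alpha> - \<beta>)) *\<^sub>R RL_integral \<beta> (ml_kernel \<alpha> m (\<alpha> - 1)) t) (at_right 0)"
    using eventually_at_right_real[OF assms(1)]
  proof eventually_elim
    case (elim t)
    have "RL_integral \<beta> (ml_kernel \<alpha> m (\<alpha> - 1)) t = ml_kernel \<alpha> m (\<alpha> - 1 + \<beta>) t"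
      using elim assms by (intro RL_integral_ml_kernel) auto
    moreover have "\<alpha> - 1 + \<beta> = ?c" "2 - \<alpha> - \<beta> = 1 - ?c"
      by auto
    ultimately show ?case by (simp only:)
  qed
  show ?thesis
    unfolding initial_condition1_def
    using assms Lim_transform_eventually[OF lim ev]
    by (auto intro!: RL_integral_exists_powr_cont[OF ml_kernel_powr_cont])
qed

text \<open>Applying I(2 - \<alpha>) to G(\<alpha>) and G(\<alpha> - 1) gives G(2) and G(1). Their
  derivatives are G(1), with limit 1 at 0, and m G(\<alpha>), which vanishes there.\<close>

lemma ml_kernel_IC2:
  assumes "0 < T" "1 < \<alpha>" "\<alpha> \<le> 2"
  shows "initial_condition2 T (\<alpha> - 1) (ml_kernel \<alpha> m \<alpha>) 1"
    and "initial_condition2 T (\<alpha> - 1) (ml_kernel \<alpha> m (\<alpha> - 1)) 0"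
proof -
  have "has_RL_derivative (\<alpha> - 1) (ml_kernel \<alpha> m \<alpha>) (ml_kernel \<alpha> m 1) T"
    by (rule has_RL_derivative_1I[OF _ _ ml_kernel_powr_cont, where W = "ml_kernel \<alpha> m 2"])
       (use assms ml_kernel_has_derivative[of \<alpha> 1] RL_integral_ml_kernel[of \<alpha> \<alpha> "2 - \<alpha>" _ m] in auto)
  moreover have "(ml_kernel \<alpha> m 1 \<longlongrightarrow> 1) (at_right 0)"
  proof -
    have lim: "((\<lambda>t. (1 * t powr (1 - 1)) *\<^sub>R ml_kernel \<alpha> m 1 t) \<longlongrightarrow> of_real (1 * rGamma 1)) (at_right 0)"
      using assms by (intro ml_kernel_tendsto) auto
    have ev: "eventually (\<lambda>t. (1 * t powr (1 - 1)) *\<^sub>R ml_kernel \<alpha> m 1 t = ml_kernel \<alpha> m 1 t) (at_right 0)"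
      using eventually_at_right_real[OF assms(1)] by eventually_elim auto
    have "rGamma 1 = (1 :: real)"
      by (simp add: rGamma_inverse_Gamma)
    then show ?thesis
      using Lim_transform_eventually[OF lim ev] by simp
  qed
  ultimately show "initial_condition2 T (\<alpha> - 1) (ml_kernel \<alpha> m \<alpha>) 1"
    unfolding initial_condition2_def by blast
  have "has_RL_derivative (\<alpha> - 1) (ml_kernel \<alpha> m (\<alpha> - 1)) (\<lambda>t. of_real m * ml_kernel \<alpha> m \<alpha> t) T"
    by (rule has_RL_derivative_1I[OF _ _ ml_kernel_powr_cont, where W = "ml_kernel \<alpha> m 1"])
       (use assms RL_integral_ml_kernel[of \<alpha> "\<alpha> - 1" "2 - \<alpha>" _ m] in \<open>auto intro!: ml_kernel_1_has_derivative\<close>)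
  moreover have "((\<lambda>t. of_real m * ml_kernel \<alpha> m \<alpha> t) \<longlongrightarrow> 0) (at_right 0)"
    by (rule powr_cont_tendsto_0[OF powr_cont_mult_left[OF ml_kernel_powr_cont] assms(1)]) (use assms in auto)
  ultimately show "initial_condition2 T (\<alpha> - 1) (ml_kernel \<alpha> m (\<alpha> - 1)) 0"
    unfolding initial_condition2_def by blast
qed

text \<open>Two derivatives lead from G(2) through G(1) to m G(\<alpha>), and from G(1) through m
  G(\<alpha>) to m G(\<alpha> - 1): in both cases the index wraps around at 1 and picks up the
  factor m.\<close>

lemma ml_kernel_solves_equation:
  assumes "0 < T" "1 < \<alpha>" "\<alpha> \<le> 2"
  shows "solves_equation T \<alpha> m (\<lambda>_. 0) (ml_kernel \<alpha> m \<alpha>)"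
    and "solves_equation T \<alpha> m (\<lambda>_. 0) (ml_kernel \<alpha> m (\<alpha> - 1))"
proof -
  have "has_RL_derivative \<alpha> (ml_kernel \<alpha> m \<alpha>) (\<lambda>t. of_real m * ml_kernel \<alpha> m \<alpha> t) T"
    by (rule has_RL_derivative_2I[OF _ _ ml_kernel_powr_cont, where W = "ml_kernel \<alpha> m 2" and W' = "ml_kernel \<alpha> m 1"])
       (use assms ml_kernel_has_derivative[of \<alpha> 1] RL_integral_ml_kernel[of \<alpha> \<alpha> "2 - \<alpha>" _ m] in
         \<open>auto intro!: ml_kernel_1_has_derivative\<close>)
  then show "solves_equation T \<alpha> m (\<lambda>_. 0) (ml_kernel \<alpha> m \<alpha>)"
    unfolding solves_equation_def by auto
  have "has_RL_derivative \<alpha> (ml_kernel \<alpha> m (\<alpha> - 1)) (\<lambda>t. of_real m * ml_kernel \<alpha> m (\<alpha> - 1) t) T"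
    by (rule has_RL_derivative_2I[OF _ _ ml_kernel_powr_cont, where W = "ml_kernel \<alpha> m 1" and W' = "\<lambda>t. of_real m * ml_kernel \<alpha> m \<alpha> t"])
       (use assms ml_kernel_has_derivative[of \<alpha> "\<alpha> - 1"] RL_integral_ml_kernel[of \<alpha> "\<alpha> - 1" "2 - \<alpha>" _ m] in
         \<open>auto intro!: ml_kernel_1_has_derivative has_vector_derivative_mult_right\<close>)
  then show "solves_equation T \<alpha> m (\<lambda>_. 0) (ml_kernel \<alpha> m (\<alpha> - 1))"
    unfolding solves_equation_def by auto
qed

lemma ml_kernel_combination_solves_problem:
  assumes "0 < T" "1 < \<alpha>" "\<alpha> \<le> 2" "0 \<le> \<beta>" "\<beta> \<le> 2 - \<alpha>"
  shows "solves_problem T \<alpha> \<beta> (\<alpha> - 1) m (\<lambda>_. 0) c1 c2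
     (\<lambda>t. of_real c2 * ml_kernel \<alpha> m \<alpha> t + of_real c1 * ml_kernel \<alpha> m (\<alpha> - 1) t)"
proof -
  have "initial_condition1 T \<alpha> \<beta> (ml_kernel \<alpha> m \<alpha>) 0"
    using assms by (intro initial_condition1_0I[OF _ _ _ _ ml_kernel_powr_cont]) auto
  then show ?thesis
    unfolding solves_problem_def
    using assms solves_equation_linear[OF _ ml_kernel_solves_equation[OF assms(1-3)], of m "of_real c2" "of_real c1"]
      initial_condition1_linear[OF _ _ _ ml_kernel_IC1[of T \<alpha> \<beta> m], of "ml_kernel \<alpha> m \<alpha>" 0 "of_real c2" "of_real c1"]
      initial_condition2_linear[OF _ ml_kernel_IC2(1)[OF assms(1-3), of m] ml_kernel_IC2(2)[OF assms(1-3), of m],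
        of "of_real c2" "of_real c1"]
    by simp
qed

lemma conv_ml_kernel_solves_problem:
  assumes f: "f \<in> powr_cont p T" "-1 < p" and "0 < T" "1 < \<alpha>" "\<alpha> \<le> 2" "0 \<le> \<beta>" "0 < \<gamma>" "\<gamma> \<le> \<alpha> - 1"
  shows "solves_problem T \<alpha> \<beta> \<gamma> m f 0 0 (conv f (ml_kernel \<alpha> m \<alpha>))"
proof -
  have u: "conv f (ml_kernel \<alpha> m \<alpha>) \<in> powr_cont (p + (\<alpha> - 1) + 1) T"
    using assms by (intro powr_cont_conv ml_kernel_powr_cont) auto
  have "has_RL_derivative \<alpha> (conv f (ml_kernel \<alpha> m \<alpha>)) (\<lambda>t. f t + of_real m * conv f (ml_kernel \<alpha> m \<alpha>) t) T"
    by (rule has_RL_derivative_2I[OF _ _ u, where W = "conv f (ml_kernel \<alpha> m 2)" and W' = "conv f (ml_kernel \<alpha> m 1)"])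
       (use assms conv_ml_kernel_has_derivative[OF f, of \<alpha> 1] RL_integral_conv_ml_kernel[OF f, of \<alpha> \<alpha> "2 - \<alpha>" _ m] in
        \<open>auto intro!: conv_ml_kernel_1_has_derivative[OF f]\<close>)
  then have "solves_equation T \<alpha> m f (conv f (ml_kernel \<alpha> m \<alpha>))"
    unfolding solves_equation_def by auto
  moreover have "initial_condition1 T \<alpha> \<beta> (conv f (ml_kernel \<alpha> m \<alpha>)) 0"
    using assms by (intro initial_condition1_0I[OF _ _ _ _ u]) auto
  moreover have "initial_condition2 T \<gamma> (conv f (ml_kernel \<alpha> m \<alpha>)) 0"
  proof -
    \<comment> \<open>The derivative of order \<gamma> lowers the index to \<alpha> - \<gamma> \<ge>
      1, leaving the exponent p + \<alpha> - \<gamma>, positive since p > -1.\<close>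
    have "has_RL_derivative \<gamma> (conv f (ml_kernel \<alpha> m \<alpha>)) (conv f (ml_kernel \<alpha> m (\<alpha> - \<gamma>))) T"
      by (rule has_RL_derivative_1I[OF _ _ u, where W = "conv f (ml_kernel \<alpha> m (\<alpha> - \<gamma> + 1))"])
         (use assms RL_integral_conv_ml_kernel[OF f, of \<alpha> \<alpha> "1 - \<gamma>" _ m] in
          \<open>auto simp: algebra_simps intro!: conv_ml_kernel_has_derivative[OF f, where b = "\<alpha> - \<gamma>", simplified]\<close>)
    moreover have "(conv f (ml_kernel \<alpha> m (\<alpha> - \<gamma>)) \<longlongrightarrow> 0) (at_right 0)"
      by (rule powr_cont_tendsto_0[OF powr_cont_conv[OF f(1) ml_kernel_powr_cont]]) (use assms in auto)
    ultimately show ?thesis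
      unfolding initial_condition2_def by blast
  qed
  ultimately show ?thesis
    by (simp add: solves_problem_def)
qed

section \<open>The classes C_{-1} and C^2_{-1}\<close>

lemma C_minus1_I: "f \<in> powr_cont p T \<Longrightarrow> -1 < p \<Longrightarrow> f \<in> C_minus1 T"
  by (auto simp: C_minus1_eq)

lemma C_minus1_E:
  assumes "f \<in> C_minus1 T"
  obtains p where "-1 < p" "f \<in> powr_cont p T"
  using assms that by (auto simp: C_minus1_eq)

lemma C_minus1_linear:
  assumes "f \<in> C_minus1 T" "g \<in> C_minus1 T"
  shows "(\<lambda>t. c * f t + d * g t) \<in> C_minus1 T"
proof -
  obtain p where p: "-1 < p" "f \<in> powr_cont p T" using assms(1) by (rule C_minus1_E) blast
  obtain q where q: "-1 < q" "g \<in> powr_cont q T" using assms(2) by (rule C_minus1_E) blast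
  have "f \<in> powr_cont (min p q) T" "g \<in> powr_cont (min p q) T"
    using powr_cont_mono[OF p(2), of "min p q"] powr_cont_mono[OF q(2), of "min p q"] by auto
  then have "(\<lambda>t. c * f t + d * g t) \<in> powr_cont (min p q) T"
    by (intro powr_cont_add powr_cont_mult_left)
  then show ?thesis
    by (rule C_minus1_I) (use p q in auto)
qed

lemma Ck_minus1_cong:
  assumes "u \<in> Ck_minus1 k T" "\<And>t. 0 < t \<Longrightarrow> t \<le> T \<Longrightarrow> u t = v t"
  shows "v \<in> Ck_minus1 k T"
proof -
  obtain g where g: "has_nth_derivative_on k u g {0<..T}" "g \<in> C_minus1 T"
    using assms(1) unfolding Ck_minus1_def by blast
  have "has_nth_derivative_on k v g {0<..T}"
    using g(1) by (subst (asm) has_nth_derivative_on_cong[where v = v and h = g]) (auto simp: assms(2))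
  with g(2) show ?thesis
    unfolding Ck_minus1_def by blast
qed

lemma Ck_minus1_diff:
  assumes "u \<in> Ck_minus1 k T" "v \<in> Ck_minus1 k T"
  shows "(\<lambda>t. u t - v t) \<in> Ck_minus1 k T"
proof -
  obtain g where g: "has_nth_derivative_on k u g {0<..T}" "g \<in> C_minus1 T"
    using assms(1) unfolding Ck_minus1_def by blast
  obtain h where h: "has_nth_derivative_on k v h {0<..T}" "h \<in> C_minus1 T"
    using assms(2) unfolding Ck_minus1_def by blast
  show ?thesis
    using has_nth_derivative_on_linear[OF g(1) h(1), of 1 "-1"] C_minus1_linear[OF g(2) h(2), of 1 "-1"]
    unfolding Ck_minus1_def by auto
qed

text \<open>Subtracting the primitive of h leaves a function with zero derivative on a convex set.
  Since p > -1, the primitive is continuous up to 0, and so is f: a derivative in C_{-1} forces a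
  limit at 0.\<close>

lemma eq_const_plus_integral:
  assumes "\<And>t. 0 < t \<Longrightarrow> t \<le> T \<Longrightarrow> (f has_vector_derivative h t) (at t within {0<..T})"
    and h: "h \<in> powr_cont p T" "-1 < p"
  obtains a where "\<And>t. 0 < t \<Longrightarrow> t \<le> T \<Longrightarrow> f t = a + conv (rl_kernel 1) h t" "f \<in> powr_cont 0 T"
proof -
  have "((\<lambda>t. f t - conv (rl_kernel 1) h t) has_vector_derivative h t - h t) (at t within {0<..T})" if "t \<in> {0<..T}" for t
    using that assms powr_cont_conv_1_has_derivative[OF h] by (intro has_vector_derivative_diff) auto
  then have "\<exists>a. \<forall>t\<in>{0<..T}. f t - conv (rl_kernel 1) h t = a"
    by (intro has_derivative_zero_constant) (auto simp: has_vector_derivative_def)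
  then obtain a where a: "\<forall>t\<in>{0<..T}. f t - conv (rl_kernel 1) h t = a"
    by blast
  then have a': "f t = a + conv (rl_kernel 1) h t" if "0 < t" "t \<le> T" for t
    using that by (auto simp: algebra_simps)
  have "conv (rl_kernel 1) h \<in> powr_cont (1 - 1 + p + 1) T"
    by (rule powr_cont_conv[OF rl_kernel_powr_cont h(1)]) (use h in auto)
  then have "conv (rl_kernel 1) h \<in> powr_cont 0 T"
    by (rule powr_cont_mono) (use h in auto)
  then have "(\<lambda>t. a + conv (rl_kernel 1) h t) \<in> powr_cont 0 T"
    by (intro powr_cont_add powr_cont_const)
  then have "f \<in> powr_cont 0 T"
    by (rule powr_cont_cong) (simp add: a')
  with a' show ?thesis by (rule that)
qed

lemma Ck_minus1_1_decomp:
  assumes "f \<in> Ck_minus1 1 T"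
  obtains a h p where "-1 < p" "h \<in> powr_cont p T"
    "\<And>t. 0 < t \<Longrightarrow> t \<le> T \<Longrightarrow> f t = a + conv (rl_kernel 1) h t" "f \<in> powr_cont 0 T"
proof -
  obtain h where h: "\<forall>t\<in>{0<..T}. (f has_vector_derivative h t) (at t within {0<..T})" "h \<in> C_minus1 T"
    using assms unfolding Ck_minus1_def has_1st_derivative_on_iff by blast
  obtain p where p: "-1 < p" "h \<in> powr_cont p T" using h(2) by (rule C_minus1_E) blast
  have "(f has_vector_derivative h t) (at t within {0<..T})" if "0 < t" "t \<le> T" for t
    using h(1) that by auto
  then obtain a where a: "\<And>t. 0 < t \<Longrightarrow> t \<le> T \<Longrightarrow> f t = a + conv (rl_kernel 1) h t" "f \<in> powr_cont 0 T"
    using eq_const_plus_integral[OF _ p(2,1), of f] by blast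
  show ?thesis by (rule that[OF p a])
qed

text \<open>The previous argument applies twice: as w'' lies in C_{-1}, the derivative k is
  continuous up to 0, and then so is w.\<close>

lemma Ck_minus1_2_decomp:
  assumes "w \<in> Ck_minus1 2 T"
  obtains a k where "k \<in> powr_cont 0 T"
    "\<And>t. 0 < t \<Longrightarrow> t \<le> T \<Longrightarrow> w t = a + conv (rl_kernel 1) k t" "w \<in> powr_cont 0 T"
proof -
  obtain k h where k: "\<forall>t\<in>{0<..T}. (w has_vector_derivative k t) (at t within {0<..T})"
    and h: "\<forall>t\<in>{0<..T}. (k has_vector_derivative h t) (at t within {0<..T})" "h \<in> C_minus1 T"
    using assms unfolding Ck_minus1_def has_2nd_derivative_on_iff by blast
  obtain p where p: "-1 < p" "h \<in> powr_cont p T" using h(2) by (rule C_minus1_E) blast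
  have "(k has_vector_derivative h t) (at t within {0<..T})" if "0 < t" "t \<le> T" for t
    using h(1) that by auto
  then have k0: "k \<in> powr_cont 0 T"
    using eq_const_plus_integral[OF _ p(2,1), of k] by blast
  have "(w has_vector_derivative k t) (at t within {0<..T})" if "0 < t" "t \<le> T" for t
    using k that by auto
  then obtain a where a: "\<And>t. 0 < t \<Longrightarrow> t \<le> T \<Longrightarrow> w t = a + conv (rl_kernel 1) k t" "w \<in> powr_cont 0 T"
    using eq_const_plus_integral[OF _ k0, of w] by auto
  show ?thesis by (rule that[OF k0 a])
qed

text \<open>Two derivatives of f * G(\<alpha>) would need index \<alpha> - 2, which is not positive
  for \<alpha> \<le> 2. Writing f = a + I(1) h moves one integration onto the kernel, so the second
  derivative has index \<alpha> - 1 > 0 and exponents above -1; the derivative of f pays for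
  this.\<close>

lemma conv_ml_kernel_C2_less:
  assumes f: "f \<in> Ck_minus1 1 T" and \<alpha>: "1 < \<alpha>"
  shows "conv f (ml_kernel \<alpha> m \<alpha>) \<in> Ck_minus1 2 T"
proof -
  obtain a h p where p: "-1 < p" and h: "h \<in> powr_cont p T"
    and fh: "\<And>t. 0 < t \<Longrightarrow> t \<le> T \<Longrightarrow> f t = a + conv (rl_kernel 1) h t"
    using Ck_minus1_1_decomp[OF f] by metis
  have eq: "conv f (ml_kernel \<alpha> m \<alpha>) t = a * ml_kernel \<alpha> m (\<alpha> + 1) t + conv h (ml_kernel \<alpha> m (\<alpha> + 1)) t"
    if t: "0 < t" "t \<le> T" for t
  proof -
    let ?G = "ml_kernel \<alpha> m \<alpha>"
    have e: "conv_exists ?G (rl_kernel 1) t" "conv_exists ?G (conv (rl_kernel 1) h) t"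
      using p t \<alpha> by (auto intro!: powr_cont_conv_exists[OF ml_kernel_powr_cont rl_kernel_powr_cont]
          powr_cont_conv_exists[OF ml_kernel_powr_cont powr_cont_conv[OF rl_kernel_powr_cont h]])
    have "conv f ?G t = conv ?G (\<lambda>s. a * rl_kernel 1 s + conv (rl_kernel 1) h s) t"
      using t fh by (subst conv_commute) (auto intro!: conv_cong simp: rl_kernel_1)
    also have "\<dots> = conv ?G (\<lambda>s. a * rl_kernel 1 s) t + conv ?G (conv (rl_kernel 1) h) t"
      by (intro conv_add_right conv_exists_mult_right e)
    also have "conv ?G (\<lambda>s. a * rl_kernel 1 s) t = a * ml_kernel \<alpha> m (\<alpha> + 1) t"
      using t \<alpha> by (simp add: conv_mult_right conv_commute[of ?G] conv_rl_kernel_ml_kernel)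
    also have "conv ?G (conv (rl_kernel 1) h) t = conv (rl_kernel 1) (conv ?G h) t"
      by (rule powr_cont_conv_commute_assoc[OF ml_kernel_powr_cont rl_kernel_powr_cont h]) (use p t \<alpha> in auto)
    also have "\<dots> = conv (rl_kernel 1) (conv h ?G) t"
      by (intro conv_cong refl conv_commute)
    also have "\<dots> = conv h (ml_kernel \<alpha> m (\<alpha> + 1)) t"
      using RL_integral_conv_ml_kernel[OF h p, of \<alpha> \<alpha> 1 t m] t \<alpha> by (simp add: RL_integral_eq_conv)
    finally show ?thesis .
  qed
  let ?D = "\<lambda>b t. a * ml_kernel \<alpha> m b t + conv h (ml_kernel \<alpha> m b) t"
  have D: "(?D (b + 1) has_vector_derivative ?D b t) (at t within {0<..T})" if "0 < b" "0 < t" "t \<le> T" for b t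
    using that \<alpha> by (intro has_vector_derivative_add has_vector_derivative_mult_right
        ml_kernel_has_derivative conv_ml_kernel_has_derivative[OF h p]) auto
  have "has_nth_derivative_on 2 (?D (\<alpha> + 1)) (?D (\<alpha> - 1)) {0<..T}"
    unfolding has_2nd_derivative_on_iff
    by (rule exI[of _ "?D \<alpha>"]) (use D[of \<alpha>] D[of "\<alpha> - 1"] \<alpha> in auto)
  then have "has_nth_derivative_on 2 (conv f (ml_kernel \<alpha> m \<alpha>)) (?D (\<alpha> - 1)) {0<..T}"
    by (subst has_nth_derivative_on_cong[OF _ refl]) (auto simp: eq)
  moreover have "(\<lambda>t. a * ml_kernel \<alpha> m (\<alpha> - 1) t + 1 * conv h (ml_kernel \<alpha> m (\<alpha> - 1)) t) \<in> C_minus1 T"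
    by (intro C_minus1_linear C_minus1_I[OF ml_kernel_powr_cont]
          C_minus1_I[OF powr_cont_conv[OF h ml_kernel_powr_cont]]) (use p \<alpha> in auto)
  ultimately show ?thesis
    unfolding Ck_minus1_def by auto
qed

text \<open>For \<alpha> = 2 the second derivative is f + m u by the equation itself, so f in C_{-1}
  is enough.\<close>

lemma conv_ml_kernel_C2_eq:
  assumes f: "f \<in> powr_cont p T" "-1 < p"
  shows "conv f (ml_kernel 2 m 2) \<in> Ck_minus1 2 T"
proof -
  have "has_nth_derivative_on 2 (conv f (ml_kernel 2 m 2)) (\<lambda>t. f t + of_real m * conv f (ml_kernel 2 m 2) t) {0<..T}"
    unfolding has_2nd_derivative_on_iff
    by (rule exI[of _ "conv f (ml_kernel 2 m 1)"])
       (use conv_ml_kernel_has_derivative[OF f, of 2 1] in \<open>auto intro!: conv_ml_kernel_1_has_derivative[OF f]\<close>)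
  moreover have "(\<lambda>t. 1 * f t + of_real m * conv f (ml_kernel 2 m 2) t) \<in> C_minus1 T"
    by (intro C_minus1_linear C_minus1_I[OF f] C_minus1_I[OF powr_cont_conv[OF f(1) ml_kernel_powr_cont]]) (use f in auto)
  ultimately show ?thesis
    unfolding Ck_minus1_def by auto
qed

section \<open>Uniqueness\<close>

lemma continuous_on_set_borel_measurable:
  fixes w :: "real \<Rightarrow> complex"
  assumes "continuous_on {0<..<T} w" "t \<le> T"
  shows "set_borel_measurable borel {0<..<t} w"
  unfolding set_borel_measurable_def using assms
  by (intro borel_measurable_continuous_on_indicator) (auto elim: continuous_on_subset)

lemma rl_kernel_measurable: "set_borel_measurable borel A (rl_kernel b)" if "A \<in> sets borel"
  unfolding set_borel_measurable_def rl_kernel_def using that by measurable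

text \<open>Here w carries no power bound at 0, so \<open>powr_cont_conv_assoc\<close> does not
  apply. Positivity makes the convolution of the moduli of the kernels the kernel of index a + b
  again, and existence at that index is enough for Fubini.\<close>

lemma rl_semigroup:
  assumes "0 < a" "0 < b" "0 < t" "set_borel_measurable borel {0<..<t} w"
    and ex: "conv_exists (rl_kernel (a + b)) w t"
  shows "conv (rl_kernel a) (conv (rl_kernel b) w) t = conv (rl_kernel (a + b)) w t"
    and "conv_exists (rl_kernel a) (conv (rl_kernel b) w) t"
proof -
  have m: "set_borel_measurable borel {0<..<t} (rl_kernel a)" "set_borel_measurable borel {0<..<t} (rl_kernel b)"
    by (auto intro: rl_kernel_measurable)
  have e: "conv_exists (rl_kernel a) (rl_kernel b) x" if "0 < x" "x < t" for x
    using that assms by (intro powr_cont_conv_exists[OF rl_kernel_powr_cont rl_kernel_powr_cont]) auto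
  have "conv_exists (conv (rl_kernel a) (rl_kernel b)) w t"
    using ex assms by (subst conv_exists_cong[of t _ "rl_kernel (a + b)" w w]) (auto simp: conv_rl_kernel)
  then have n: "conv_exists (conv (\<lambda>s. of_real (norm (rl_kernel a s))) (\<lambda>s. of_real (norm (rl_kernel b s)))) w t"
    using assms by (simp add: rl_kernel_norm)
  show "conv_exists (rl_kernel a) (conv (rl_kernel b) w) t"
    by (rule conv_exists_assoc[OF m assms(4) e n])
  have "conv (rl_kernel a) (conv (rl_kernel b) w) t = conv (conv (rl_kernel a) (rl_kernel b)) w t"
    by (rule conv_assoc[OF m assms(4) e n])
  also have "\<dots> = conv (rl_kernel (a + b)) w t"
    using assms by (intro conv_cong conv_rl_kernel) auto
  finally show "conv (rl_kernel a) (conv (rl_kernel b) w) t = conv (rl_kernel (a + b)) w t" .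
qed

lemma rl_kernel_conv_measurable:
  assumes "set_borel_measurable borel {0<..<t} w"
  shows "set_borel_measurable borel {0<..<t} (\<lambda>s. rl_kernel c (t - s) * w s)"
proof -
  have [measurable]: "(\<lambda>s. indicator {0<..<t} s *\<^sub>R w s) \<in> borel_measurable borel"
    using assms by (simp add: set_borel_measurable_def)
  have "(\<lambda>s. rl_kernel c (t - s) * (indicator {0<..<t} s *\<^sub>R w s)) \<in> borel_measurable borel"
    unfolding rl_kernel_def by measurable
  then show ?thesis
    by (simp add: set_borel_measurable_def)
qed

text \<open>For c \<ge> 1 the kernel on (0, t) is bounded by its value at t.\<close>

lemma conv_exists_rl_kernel_ge_1:
  assumes w: "set_integrable lborel {0<..<t} w" "set_borel_measurable borel {0<..<t} w" and c: "1 \<le> c"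
  shows "conv_exists (rl_kernel c) w t"
  unfolding conv_exists_def
proof (rule set_integrable_bound)
  show "set_integrable lborel {0<..<t} (\<lambda>s. of_real (rGamma c * t powr (c - 1)) * w s)"
    using w(1) by (rule set_integrable_mult_right)
  show "set_borel_measurable lborel {0<..<t} (\<lambda>s. rl_kernel c (t - s) * w s)"
    using rl_kernel_conv_measurable[OF w(2)] by (simp add: set_borel_measurable_def)
  have "rGamma c > 0" using c by (intro rGamma_real_pos) auto
  moreover have "(t - s) powr (c - 1) \<le> t powr (c - 1)" if "0 < s" "s < t" for s
    using c that by (intro powr_mono2) auto
  ultimately show "AE s in lborel. s \<in> {0<..<t} \<longrightarrow> norm (rl_kernel c (t - s) * w s) \<le> norm (of_real (rGamma c * t powr (c - 1)) * w s)"
    by (intro AE_I2) (auto simp: rl_kernel_def norm_mult intro!: mult_mono)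
qed

text \<open>For c \<le> 1 the kernel on (0, t) is at least its value at t, so existence of I(c) w
  gives integrability of w. With c = 2 - \<alpha> and \<alpha> < 2 the equation itself thus makes w
  integrable near 0.\<close>

lemma conv_exists_rl_kernel_le_1:
  assumes w: "conv_exists (rl_kernel c) w t" "set_borel_measurable borel {0<..<t} w" and c: "0 < c" "c \<le> 1"
  shows "set_integrable lborel {0<..<t} w"
proof (rule set_integrable_bound)
  show "set_integrable lborel {0<..<t} (\<lambda>s. of_real (1 / (rGamma c * t powr (c - 1))) * (rl_kernel c (t - s) * w s))"
    using w(1) unfolding conv_exists_def by (rule set_integrable_mult_right)
  show "set_borel_measurable lborel {0<..<t} w"
    using w(2) by (simp add: set_borel_measurable_def)
  have r: "rGamma c > 0" using c by (intro rGamma_real_pos) auto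
  show "AE s in lborel. s \<in> {0<..<t} \<longrightarrow> norm (w s) \<le> norm (of_real (1 / (rGamma c * t powr (c - 1))) * (rl_kernel c (t - s) * w s))"
  proof (intro AE_I2 impI)
    fix s assume s: "s \<in> {0<..<t}"
    have "t powr (c - 1) \<le> (t - s) powr (c - 1)"
      using c s by (intro powr_mono2') auto
    moreover have "0 < t powr (c - 1)" using s by auto
    ultimately have "1 * norm (w s) \<le> ((t - s) powr (c - 1) / t powr (c - 1)) * norm (w s)"
      by (intro mult_right_mono) auto
    also have "\<dots> = norm (of_real (1 / (rGamma c * t powr (c - 1))) * (rl_kernel c (t - s) * w s))"
      using r s by (simp add: rl_kernel_def norm_mult norm_divide)
    finally show "norm (w s) \<le> norm (of_real (1 / (rGamma c * t powr (c - 1))) * (rl_kernel c (t - s) * w s))"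
      by simp
  qed
qed

text \<open>The limit l supplies the value at 0; staying below T keeps away from the right end,
  where F is not controlled.\<close>

lemma powr_cont_0_of_tendsto:
  assumes "continuous_on {0<..<T} F" "(F \<longlongrightarrow> l) (at_right 0)" "T' < T"
  shows "F \<in> powr_cont 0 T'"
proof (rule powr_contI)
  show "continuous_on {0..T'} (\<lambda>x. if x = 0 then l else F x)"
    unfolding continuous_on_def
  proof
    fix x assume x: "x \<in> {0..T'}"
    show "((\<lambda>x. if x = 0 then l else F x) \<longlongrightarrow> (if x = 0 then l else F x)) (at x within {0..T'})"
    proof (cases "x = 0")
      case True
      have "((\<lambda>x. if x = 0 then l else F x) \<longlongrightarrow> l) (at_right 0)"
        using assms(2) by (rule tendsto_cong[THEN iffD1, rotated]) (auto simp: eventually_at_filter)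
      then have "((\<lambda>x. if x = 0 then l else F x) \<longlongrightarrow> l) (at 0 within {0..})"
        by (simp only: at_within_Ici_at_right)
      then show ?thesis using True by (auto elim: tendsto_within_subset)
    next
      case False
      then have x': "x \<in> {0<..<T}" using x assms(3) by auto
      then have "(F \<longlongrightarrow> F x) (at x)"
        using assms(1) by (auto simp: continuous_on_eq_continuous_at isCont_def)
      moreover have "eventually (\<lambda>y. F y = (if y = 0 then l else F y)) (at x)"
        using eventually_at_in_open[OF open_greaterThanLessThan x'] by (rule eventually_mono) auto
      ultimately have "((\<lambda>x. if x = 0 then l else F x) \<longlongrightarrow> F x) (at x)"
        by (rule Lim_transform_eventually)
      then show ?thesis
        using False by (auto intro: tendsto_within_subset)
    qed
  qed
qed auto

text \<open>Iterating the inequality bounds \<open>V\<close> by the \<open>n\<close>-th term of an exponential series, for every \<open>n\<close>.\<close>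

lemma volterra_zero:
  assumes V: "V \<in> powr_cont 0 T" and c: "1 \<le> c"
    and eq: "\<And>t. 0 < t \<Longrightarrow> t \<le> T \<Longrightarrow> V t = of_real m * conv (rl_kernel c) V t" and t: "0 < t" "t \<le> T"
  shows "V t = 0"
proof -
  from V obtain V1 where V1: "continuous_on {0..T} V1" "\<And>x. 0 < x \<Longrightarrow> x \<le> T \<Longrightarrow> V x = (x powr 0) *\<^sub>R V1 x"
    by (rule powr_contE) blast
  obtain B where B: "\<And>x. x \<in> {0..T} \<Longrightarrow> norm (V1 x) \<le> B"
    using compact_imp_bounded[OF compact_continuous_image[OF V1(1) compact_Icc]] unfolding bounded_iff by (metis imageI)
  \<comment> \<open>L bounds the kernel on (0, T] because c \<ge> 1, and each iteration costs one
    factor K.\<close>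
  define L where "L = rGamma c * T powr (c - 1)"
  define K where "K = \<bar>m\<bar> * L"
  have rc: "rGamma c > 0" using c by (intro rGamma_real_pos) auto
  have bound: "norm (V t) \<le> B * K ^ n * (rGamma (real n + 1) * t powr real n)" if "0 < t" "t \<le> T" for n t
    using that
  proof (induction n arbitrary: t)
    case 0
    then show ?case using B[of t] by (simp add: V1 rGamma_inverse_Gamma)
  next
    case (Suc n)
    \<comment> \<open>The majorant is a multiple of the kernel of index n + 1, and the constant L is
      L times the kernel of index 1; their convolution has index n + 2, which produces the next
      factorial.\<close>
    let ?q = "\<lambda>s. B * K ^ n * (rGamma (real n + 1) * s powr real n)"
    have q: "(\<lambda>s. complex_of_real (?q s)) = (\<lambda>s. of_real (B * K ^ n) * rl_kernel (real n + 1) s)"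
      by (auto simp: rl_kernel_def)
    have L: "conv (\<lambda>s. complex_of_real L) g t = of_real L * conv (rl_kernel 1) g t" for g
    proof -
      have "conv (\<lambda>s. complex_of_real L) g t = conv g (\<lambda>s. of_real L * rl_kernel 1 s) t"
        by (subst conv_commute) (intro conv_cong, auto simp: rl_kernel_1)
      then show ?thesis by (simp add: conv_mult_right conv_commute[of g])
    qed
    have "norm (conv (rl_kernel c) V t) \<le> Re (conv (\<lambda>s. of_real L) (\<lambda>s. of_real (?q s)) t)"
    proof (rule norm_conv_le)
      show "conv_exists (rl_kernel c) V t"
        using c Suc.prems by (intro powr_cont_conv_exists[OF rl_kernel_powr_cont V]) auto
      show "conv_exists (\<lambda>s. of_real L) (\<lambda>s. of_real (?q s)) t"
        unfolding q using Suc.prems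
        by (intro powr_cont_conv_exists[OF powr_cont_const powr_cont_mult_left[OF rl_kernel_powr_cont]]) auto
      show "norm (rl_kernel c s) \<le> L" if "0 < s" "s < t" for s
        using rc c that Suc.prems by (auto simp: rl_kernel_def L_def norm_mult intro!: mult_left_mono powr_mono2)
      show "norm (V s) \<le> ?q s" if "0 < s" "s < t" for s
        using Suc.IH[of s] Suc.prems that by simp
    qed
    also have "conv (\<lambda>s. of_real L) (\<lambda>s. of_real (?q s)) t = of_real (L * (B * K ^ n)) * rl_kernel (1 + (real n + 1)) t"
      unfolding q L conv_mult_right using Suc.prems by (simp add: conv_rl_kernel)
    also have "\<dots> = of_real (L * (B * K ^ n) * (rGamma (real (Suc n) + 1) * t powr real (Suc n)))"
      by (simp add: rl_kernel_def add_ac)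
    finally have "norm (conv (rl_kernel c) V t) \<le> L * (B * K ^ n) * (rGamma (real (Suc n) + 1) * t powr real (Suc n))"
      by (simp only: Re_complex_of_real)
    then have "\<bar>m\<bar> * norm (conv (rl_kernel c) V t) \<le> \<bar>m\<bar> * (L * (B * K ^ n) * (rGamma (real (Suc n) + 1) * t powr real (Suc n)))"
      by (intro mult_left_mono) auto
    then show ?case
      using eq[OF Suc.prems] by (simp add: K_def norm_mult mult_ac)
  qed
  \<comment> \<open>With both parameters equal to 1 the Mittag-Leffler series is the exponential
    series, so its terms tend to 0.\<close>
  have "(\<lambda>n. rGamma (1 * real n + 1) * (K * t) ^ n) \<longlonglongrightarrow> 0"
    by (intro summable_LIMSEQ_zero mittag_leffler_summable) auto
  then have "(\<lambda>n. B * (rGamma (1 * real n + 1) * (K * t) ^ n)) \<longlonglongrightarrow> B * 0"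
    by (intro tendsto_intros)
  moreover have "(\<lambda>n. B * (rGamma (1 * real n + 1) * (K * t) ^ n)) = (\<lambda>n. B * K ^ n * (rGamma (real n + 1) * t powr real n))"
    using t by (simp add: fun_eq_iff powr_realpow power_mult_distrib)
  ultimately have "(\<lambda>n. B * K ^ n * (rGamma (real n + 1) * t powr real n)) \<longlonglongrightarrow> 0"
    by (simp only: mult_zero_right)
  then have "norm (V t) \<le> 0"
    by (rule LIMSEQ_le_const) (use bound[OF t] in auto)
  then show ?thesis by simp
qed

text \<open>Differentiating the vanishing primitive gives w = 0 at every point, as w is continuous;
  the midpoint T' provides a half-closed interval inside (0, T) on which the primitive is
  differentiable.\<close>

lemma zero_if_integrals_zero:
  fixes w :: "real \<Rightarrow> complex"
  assumes "continuous_on {0<..<T} w" "\<And>t. 0 < t \<Longrightarrow> t < T \<Longrightarrow> set_integrable lborel {0<..<t} w"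
    and z: "\<And>t. 0 < t \<Longrightarrow> t < T \<Longrightarrow> (LBINT s=0..t. w s) = 0" and t: "0 < t" "t < T"
  shows "w t = 0"
proof -
  define T' where "T' = (t + T) / 2"
  have T': "t < T'" "T' < T" using t by (auto simp: T'_def)
  have "((\<lambda>t. LBINT s=0..t. w s) has_vector_derivative w t) (at t within {0<..T'})"
    using T' t by (intro integral_from_0_has_vector_derivative continuous_on_subset[OF assms(1)] assms(2)) auto
  then have "((\<lambda>t. LBINT s=0..t. w s) has_vector_derivative w t) (at t within {0<..<T'})"
    by (rule at_within_Ioo_of_Ioc)
  then have "((\<lambda>t. LBINT s=0..t. w s) has_vector_derivative w t) (at t)"
    using T' t by (subst (asm) has_vector_derivative_within_open) auto
  then have "((\<lambda>_. 0) has_vector_derivative w t) (at t)"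
    by (rule has_vector_derivative_transform_within_open[of _ _ _ "{0<..<T}"]) (use t z in auto)
  then show ?thesis
    using vector_derivative_unique_at has_vector_derivative_const by blast
qed

text \<open>Collects what both uniqueness proofs deliver. Passing from w to V trades a possibly
  unbounded function for one continuous up to 0, and the semigroup law lets m I(2) w be read as m
  I(\<alpha>) V.\<close>

lemma uniqueness_core:
  assumes \<alpha>: "1 < \<alpha>" "\<alpha> \<le> 2" and w: "continuous_on {0<..<T} w"
    and wi: "\<And>t. 0 < t \<Longrightarrow> t < T \<Longrightarrow> set_integrable lborel {0<..<t} w"
    and ex: "\<And>t. 0 < t \<Longrightarrow> t < T \<Longrightarrow> RL_integral_exists (2 - \<alpha>) w t"
    and V: "\<And>t. 0 < t \<Longrightarrow> t < T \<Longrightarrow> (RL_integral (2 - \<alpha>) w has_vector_derivative v t) (at t)"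
    and v: "\<And>t. 0 < t \<Longrightarrow> t < T \<Longrightarrow> (v has_vector_derivative of_real m * w t) (at t)"
    and V0: "(RL_integral (2 - \<alpha>) w \<longlongrightarrow> 0) (at_right 0)" and v0: "(v \<longlongrightarrow> 0) (at_right 0)"
    and t: "0 < t" "t < T"
  shows "w t = 0"
proof -
  define V' where "V' = RL_integral (2 - \<alpha>) w"
  note wm = continuous_on_set_borel_measurable[OF w]
  have Vc: "continuous_on {0<..<T} V'" and vc: "continuous_on {0<..<T} v"
    using has_vector_derivative_continuous[OF V] has_vector_derivative_continuous[OF v]
    by (auto simp: V'_def continuous_on_eq_continuous_at)
  have VP: "V' \<in> powr_cont 0 t" and vP: "v \<in> powr_cont 0 t" if "t < T" for t
    using powr_cont_0_of_tendsto[OF Vc, of 0 t] powr_cont_0_of_tendsto[OF vc v0, of t] V0 that by (auto simp: V'_def)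
  have v_eq: "v t = of_real m * conv (rl_kernel 1) w t" if "0 < t" "t < T" for t
  proof -
    have "v t = 0 + (LBINT s=0..t. of_real m * w s)"
      by (rule antiderivative_eq_integral[OF v _ _ v0])
         (use w wi that in \<open>auto intro!: continuous_intros\<close>)
    then show ?thesis
      using that by (simp add: conv_rl_kernel_1)
  qed
  have V_eq: "V' t = of_real m * conv (rl_kernel 2) w t" if "0 < t" "t < T" for t
  proof -
    have "V' t = 0 + (LBINT s=0..t. v s)"
      unfolding V'_def
      by (rule antiderivative_eq_integral[OF V vc _ V0])
         (use powr_cont_integrable[OF vP[OF that(2)]] that in auto)
    also have "\<dots> = conv (rl_kernel 1) v t"
      using that by (simp add: conv_rl_kernel_1)
    also have "\<dots> = conv (rl_kernel 1) (\<lambda>s. of_real m * conv (rl_kernel 1) w s) t"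
      using that v_eq by (intro conv_cong) auto
    also have "\<dots> = of_real m * conv (rl_kernel (1 + 1)) w t"
      unfolding conv_mult_right using that
      by (subst rl_semigroup) (auto intro!: wm wi conv_exists_rl_kernel_ge_1)
    finally show ?thesis by simp
  qed
  \<comment> \<open>The condition on c makes the kernel of total index bounded, so its convolution
    with the integrable w exists. It is used with c = \<alpha>, total index 2, and with c = \<alpha>
    - 1, total index 1.\<close>
  have V_conv: "conv (rl_kernel c) V' t = conv (rl_kernel (c + (2 - \<alpha>))) w t"
    if "0 < c" "1 \<le> c + (2 - \<alpha>)" "0 < t" "t < T" for c t
  \<comment> \<open>For \<alpha> = 2 the integral of order 0 is the identity, whereas
    \<open>rl_kernel 0\<close> is the zero function since \<open>rGamma 0 = 0\<close>.\<close>
  proof (cases "\<alpha> = 2")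
    case True
    then show ?thesis by (simp add: V'_def RL_integral_0)
  next
    case False
    then have "conv (rl_kernel c) V' t = conv (rl_kernel c) (conv (rl_kernel (2 - \<alpha>)) w) t"
      using \<alpha> by (intro conv_cong) (auto simp: V'_def RL_integral_eq_conv)
    also have "\<dots> = conv (rl_kernel (c + (2 - \<alpha>))) w t"
      using that False \<alpha> by (intro rl_semigroup) (auto intro!: wm wi conv_exists_rl_kernel_ge_1)
    finally show ?thesis .
  qed
  have V_zero: "V' t = 0" if "0 < t" "t < T" for t
  proof (rule volterra_zero[OF VP[OF that(2)]])
    show "V' s = of_real m * conv (rl_kernel \<alpha>) V' s" if "0 < s" "s \<le> t" for s
      using V_conv[of \<alpha> s] V_eq[of s] that \<open>t < T\<close> \<alpha> by simp
  qed (use \<alpha> that in auto)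
  have "(LBINT s=0..t. w s) = 0" if "0 < t" "t < T" for t
  proof -
    \<comment> \<open>The zero function is written as 0 * V' so that \<open>conv_mult_right\<close>
      pulls out the factor.\<close>
    have "conv (rl_kernel (\<alpha> - 1)) V' t = conv (rl_kernel (\<alpha> - 1)) (\<lambda>s. 0 * V' s) t"
      using that V_zero by (intro conv_cong) auto
    then have "conv (rl_kernel 1) w t = 0"
      unfolding conv_mult_right using V_conv[of "\<alpha> - 1" t] that \<alpha> by simp
    then show ?thesis
      using that by (simp add: conv_rl_kernel_1)
  qed
  then show ?thesis
    using zero_if_integrals_zero[OF w wi _ t] by blast
qed

text \<open>The factor \<open>Gamma (\<alpha> + \<beta> - 1)\<close> in the initial condition turns \<open>I(\<beta>) w = o(t powr -d)\<close>,
  \<open>d = 2 - \<alpha> - \<beta>\<close>, into a bound by \<open>\<epsilon> * rl_kernel (1 - d)\<close>, whose fractional integral of order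
  \<open>d\<close> is the constant \<open>\<epsilon>\<close>.\<close>

lemma RL_integral_tendsto_0:
  assumes T: "0 < T" and \<alpha>: "1 < \<alpha>" "\<alpha> \<le> 2" and \<beta>: "0 \<le> \<beta>" "\<beta> \<le> 2 - \<alpha>"
    and w: "continuous_on {0<..<T} w"
    and ex: "\<And>t. 0 < t \<Longrightarrow> t < T \<Longrightarrow> RL_integral_exists (2 - \<alpha>) w t"
    and ic: "initial_condition1 T \<alpha> \<beta> w 0"
  shows "(RL_integral (2 - \<alpha>) w \<longlongrightarrow> 0) (at_right 0)"
proof (cases "\<beta> = 2 - \<alpha>")
  case True
  \<comment> \<open>Here \<alpha> + \<beta> - 1 = 1, so the weight is Gamma 1 * t powr 0 = 1 and the
    condition is already the claim.\<close>
  have "((\<lambda>t. (Gamma (\<alpha> + \<beta> - 1) * t powr (2 - \<alpha> - \<beta>)) *\<^sub>R RL_integral \<beta> w t) \<longlongrightarrow> 0) (at_right 0)"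
    using ic by (simp add: initial_condition1_def)
  moreover have "eventually (\<lambda>t. (Gamma (\<alpha> + \<beta> - 1) * t powr (2 - \<alpha> - \<beta>)) *\<^sub>R RL_integral \<beta> w t
      = RL_integral (2 - \<alpha>) w t) (at_right 0)"
    using eventually_at_right_real[OF T] by eventually_elim (simp add: True)
  ultimately show ?thesis
    by (rule Lim_transform_eventually)
next
  case False
  \<comment> \<open>With h = I(\<beta>) w the semigroup law reads I(2 - \<alpha>) w = I(d) h.
    Excluding \<beta> = 2 - \<alpha> gives d > 0, and \<alpha> > 1 gives d < 1, so the kernels of
    index d and 1 - d are both integrable.\<close>
  define d where "d = 2 - \<alpha> - \<beta>"
  have d: "0 < d" "d < 1" using False \<alpha> \<beta> by (auto simp: d_def)
  define h where "h = RL_integral \<beta> w"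
  note wm = continuous_on_set_borel_measurable[OF w]
  have Vh: "RL_integral (2 - \<alpha>) w t = conv (rl_kernel d) h t \<and> conv_exists (rl_kernel d) h t" if t: "0 < t" "t < T" for t
  proof -
    have e: "conv_exists (rl_kernel (2 - \<alpha>)) w t"
      using ex[OF t] t d \<beta> by (simp add: RL_integral_exists_iff d_def)
    have V: "RL_integral (2 - \<alpha>) w t = conv (rl_kernel (2 - \<alpha>)) w t"
      using t d \<beta> by (simp add: RL_integral_eq_conv d_def)
    show ?thesis
    proof (cases "\<beta> = 0")
      case True
      then show ?thesis using V e by (simp add: h_def d_def RL_integral_0)
    next
      case False
      then have \<beta>0: "0 < \<beta>" using \<beta> by simp
      have "conv (rl_kernel d) h t = conv (rl_kernel d) (conv (rl_kernel \<beta>) w) t"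
           "conv_exists (rl_kernel d) h t = conv_exists (rl_kernel d) (conv (rl_kernel \<beta>) w) t"
        using \<beta>0 by (auto simp: h_def RL_integral_eq_conv intro!: conv_cong conv_exists_cong)
      then show ?thesis
        using rl_semigroup[OF d(1) \<beta>0 t(1) wm] e t V by (simp add: d_def)
    qed
  qed
  have r: "0 < rGamma d" "0 < rGamma (1 - d)" using d by (auto intro!: rGamma_real_pos)
  show ?thesis
  proof (rule tendstoI)
    fix \<epsilon> :: real assume "0 < \<epsilon>"
    define e where "e = \<epsilon> / 2"
    have e: "0 < e" "e < \<epsilon>" using \<open>0 < \<epsilon>\<close> by (auto simp: e_def)
    have "((\<lambda>t. (Gamma (\<alpha> + \<beta> - 1) * t powr (2 - \<alpha> - \<beta>)) *\<^sub>R h t) \<longlongrightarrow> 0) (at_right 0)"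
      using ic by (simp add: initial_condition1_def h_def)
    then have "((\<lambda>t. (Gamma (1 - d) * t powr d) *\<^sub>R h t) \<longlongrightarrow> 0) (at_right 0)"
      by (simp add: d_def algebra_simps)
    then have "eventually (\<lambda>t. norm ((Gamma (1 - d) * t powr d) *\<^sub>R h t) < e) (at_right 0)"
      using tendstoD[OF _ e(1)] by fastforce
    then obtain b where b: "0 < b" "\<And>t. 0 < t \<Longrightarrow> t < b \<Longrightarrow> norm ((Gamma (1 - d) * t powr d) *\<^sub>R h t) < e"
      by (auto simp: eventually_at_right_field)
    have G: "0 < Gamma (1 - d)" using d by auto
    have hb: "norm (h s) \<le> e * (rGamma (1 - d) * s powr (1 - d - 1))" if "0 < s" "s < b" for s
      using b(2)[OF that] G that by (simp add: rGamma_inverse_Gamma powr_minus field_simps)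
    have "norm (RL_integral (2 - \<alpha>) w t) \<le> e" if t: "0 < t" "t < b" "t < T" for t
    proof -
      have q: "(\<lambda>s. complex_of_real (e * (rGamma (1 - d) * s powr (1 - d - 1)))) = (\<lambda>s. of_real e * rl_kernel (1 - d) s)"
        by (auto simp: rl_kernel_def)
      have p: "(\<lambda>s. complex_of_real (rGamma d * s powr (d - 1))) = rl_kernel d"
        by (auto simp: rl_kernel_def)
      have "norm (conv (rl_kernel d) h t) \<le> Re (conv (\<lambda>s. complex_of_real (rGamma d * s powr (d - 1)))
           (\<lambda>s. complex_of_real (e * (rGamma (1 - d) * s powr (1 - d - 1)))) t)"
      proof (rule norm_conv_le)
        show "conv_exists (rl_kernel d) h t" using Vh t by auto
        show "conv_exists (\<lambda>s. complex_of_real (rGamma d * s powr (d - 1)))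
           (\<lambda>s. complex_of_real (e * (rGamma (1 - d) * s powr (1 - d - 1)))) t"
          unfolding p q
          by (rule powr_cont_conv_exists[OF rl_kernel_powr_cont powr_cont_mult_left[OF rl_kernel_powr_cont]])
             (use d t in auto)
        show "norm (rl_kernel d s) \<le> rGamma d * s powr (d - 1)" for s
          using r by (simp add: rl_kernel_def norm_mult)
      qed (use hb t in auto)
      also have "\<dots> = e"
        unfolding p q conv_mult_right using d t by (simp add: conv_rl_kernel rl_kernel_1)
      finally show ?thesis
        using Vh t by simp
    qed
    then have "eventually (\<lambda>t. norm (RL_integral (2 - \<alpha>) w t) \<le> e) (at_right 0)"
      using b(1) T eventually_at_right_real[of 0 "min b T"] by (auto elim!: eventually_mono)
    then show "eventually (\<lambda>t. dist (RL_integral (2 - \<alpha>) w t) 0 < \<epsilon>) (at_right 0)"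
      using e by (auto elim!: eventually_mono)
  qed
qed

section \<open>Uniqueness for \<gamma> = \<alpha> - 1 among functions continuous on (0, T)\<close>

lemma homogeneous_equationE:
  assumes \<alpha>: "1 < \<alpha>" "\<alpha> \<le> 2" and sol: "solves_equation T \<alpha> m (\<lambda>_. 0) w"
  obtains v where "\<And>t. 0 < t \<Longrightarrow> t < T \<Longrightarrow> RL_integral_exists (2 - \<alpha>) w t"
    "\<And>t. 0 < t \<Longrightarrow> t < T \<Longrightarrow> (RL_integral (2 - \<alpha>) w has_vector_derivative v t) (at t)"
    "\<And>t. 0 < t \<Longrightarrow> t < T \<Longrightarrow> (v has_vector_derivative of_real m * w t) (at t)"
proof -
  obtain g where g: "has_RL_derivative \<alpha> w g T" and "\<forall>t\<in>{0<..<T}. g t - of_real m * w t = 0"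
    using sol unfolding solves_equation_def by blast
  then have gw: "g t = of_real m * w t" if "t \<in> {0<..<T}" for t
    using that by (metis right_minus_eq)
  have "\<forall>t\<in>{0<..<T}. RL_integral_exists (2 - \<alpha>) w t"
    and "has_nth_derivative_on 2 (RL_integral (2 - \<alpha>) w) g {0<..<T}"
    using g has_RL_derivative_iff[of 2 \<alpha> w g T] \<alpha> by auto
  moreover from this(2) obtain v where
    "\<forall>t\<in>{0<..<T}. (RL_integral (2 - \<alpha>) w has_vector_derivative v t) (at t within {0<..<T})"
    and "\<forall>t\<in>{0<..<T}. (v has_vector_derivative g t) (at t within {0<..<T})"
    unfolding has_2nd_derivative_on_iff by blast
  ultimately show ?thesis
    by (intro that[of v]) (simp_all add: has_vector_derivative_within_open[where S = "{0<..<T}"] gw)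
qed

lemma initial_condition2E:
  assumes \<gamma>: "0 < \<gamma>" "\<gamma> \<le> 1" and ic: "initial_condition2 T \<gamma> w c"
  obtains l where "\<And>t. 0 < t \<Longrightarrow> t < T \<Longrightarrow> (RL_integral (1 - \<gamma>) w has_vector_derivative l t) (at t)"
    "(l \<longlongrightarrow> c) (at_right 0)"
proof -
  obtain l where l: "has_RL_derivative \<gamma> w l T" "(l \<longlongrightarrow> c) (at_right 0)"
    using ic unfolding initial_condition2_def by blast
  have "has_nth_derivative_on 1 (RL_integral (1 - \<gamma>) w) l {0<..<T}"
    using l(1) has_RL_derivative_iff[of 1 \<gamma> w l T] \<gamma> by simp
  then have "\<forall>t\<in>{0<..<T}. (RL_integral (1 - \<gamma>) w has_vector_derivative l t) (at t within {0<..<T})"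
    unfolding has_1st_derivative_on_iff .
  then show ?thesis
    using l(2) by (intro that[of l]) (simp_all add: has_vector_derivative_within_open[where S = "{0<..<T}"])
qed

text \<open>Since 1 - (\<alpha> - 1) = 2 - \<alpha>, the derivative in the second initial condition
  is V' itself, so V' tends to 0; the first condition makes V tend to 0.\<close>

lemma uniqueness_gamma_max:
  assumes T: "0 < T" and \<alpha>: "1 < \<alpha>" "\<alpha> \<le> 2" and \<beta>: "0 \<le> \<beta>" "\<beta> \<le> 2 - \<alpha>"
    and w: "continuous_on {0<..<T} w" and sol: "solves_problem T \<alpha> \<beta> (\<alpha> - 1) m (\<lambda>_. 0) 0 0 w"
    and t: "0 < t" "t < T"
  shows "w t = 0"
proof -
  let ?V = "RL_integral (2 - \<alpha>) w"
  have ic1: "initial_condition1 T \<alpha> \<beta> w 0"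
    using sol by (simp add: solves_problem_def)
  have "solves_equation T \<alpha> m (\<lambda>_. 0) w"
    using sol by (simp add: solves_problem_def)
  then obtain v where ex: "\<And>t. 0 < t \<Longrightarrow> t < T \<Longrightarrow> RL_integral_exists (2 - \<alpha>) w t"
    and V: "\<And>t. 0 < t \<Longrightarrow> t < T \<Longrightarrow> (?V has_vector_derivative v t) (at t)"
    and v: "\<And>t. 0 < t \<Longrightarrow> t < T \<Longrightarrow> (v has_vector_derivative of_real m * w t) (at t)"
    by (rule homogeneous_equationE[OF \<alpha>]) blast
  have "initial_condition2 T (\<alpha> - 1) w 0"
    using sol by (simp add: solves_problem_def)
  then obtain k where "\<And>t. 0 < t \<Longrightarrow> t < T \<Longrightarrow> (RL_integral (1 - (\<alpha> - 1)) w has_vector_derivative k t) (at t)"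
    and k: "(k \<longlongrightarrow> 0) (at_right 0)"
    by (rule initial_condition2E[rotated 2]) (use \<alpha> in auto)
  then have V_k: "(?V has_vector_derivative k t) (at t)" if "0 < t" "t < T" for t
    using that by simp
  have "k t = v t" if "0 < t" "t < T" for t
    by (rule vector_derivative_unique_at[OF V_k[OF that] V[OF that]])
  then have "eventually (\<lambda>t. k t = v t) (at_right 0)"
    using eventually_at_right_real[OF T] by (auto elim!: eventually_mono)
  with k have v0: "(v \<longlongrightarrow> 0) (at_right 0)"
    by (rule Lim_transform_eventually)
  have V0: "(?V \<longlongrightarrow> 0) (at_right 0)"
    by (rule RL_integral_tendsto_0[OF T \<alpha> \<beta> w ex ic1])
  note wm = continuous_on_set_borel_measurable[OF w]
  \<comment> \<open>For \<alpha> = 2, V is w and has a limit at 0; otherwise existence of I(2 -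
    \<alpha>) w suffices, its order being below 1.\<close>
  have wi: "set_integrable lborel {0<..<t} w" if t: "0 < t" "t < T" for t
  proof (cases "\<alpha> = 2")
    case True
    then have "(w \<longlongrightarrow> 0) (at_right 0)" using V0 by (simp add: RL_integral_0)
    then show ?thesis
      by (intro powr_cont_integrable[OF powr_cont_0_of_tendsto[OF w _ t(2)]]) auto
  next
    case False
    then show ?thesis
      using ex[OF t] t \<alpha> wm[of t] by (intro conv_exists_rl_kernel_le_1[of "2 - \<alpha>"]) (auto simp: RL_integral_exists_iff)
  qed
  show ?thesis
    by (rule uniqueness_core[OF \<alpha> w wi ex V v V0 v0 t])
qed

section \<open>Uniqueness in C^2_{-1} for \<alpha> < 2\<close>

lemma RL_integral_of_primitive:
  assumes k: "k \<in> powr_cont 0 T" and w: "\<And>t. 0 < t \<Longrightarrow> t \<le> T \<Longrightarrow> w t = a + conv (rl_kernel 1) k t"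
    and c: "0 < c" and t: "0 < t" "t \<le> T"
  shows "RL_integral c w t = conv (rl_kernel 1) (\<lambda>s. a * rl_kernel c s + conv (rl_kernel c) k s) t"
proof -
  let ?g = "rl_kernel"
  have ck: "conv (?g c) k \<in> powr_cont (c - 1 + 0 + 1) T" "conv (?g 1) k \<in> powr_cont (1 - 1 + 0 + 1) T"
    by (rule powr_cont_conv[OF rl_kernel_powr_cont k]; use c in simp)+
  have "RL_integral c w t = conv (?g c) (\<lambda>s. a * ?g 1 s + conv (?g 1) k s) t"
    using t c w by (auto simp: RL_integral_eq_conv rl_kernel_1 intro!: conv_cong)
  also have "\<dots> = a * conv (?g c) (?g 1) t + conv (?g c) (conv (?g 1) k) t"
    unfolding conv_mult_right[symmetric]
    by (intro conv_add_right conv_exists_mult_right powr_cont_conv_exists[OF rl_kernel_powr_cont rl_kernel_powr_cont]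
        powr_cont_conv_exists[OF rl_kernel_powr_cont ck(2)]) (use c t in auto)
  \<comment> \<open>Commuting the kernels brings I(1) to the outside, ready for
    differentiation.\<close>
  also have "\<dots> = a * conv (?g 1) (?g c) t + conv (?g 1) (conv (?g c) k) t"
    using powr_cont_conv_commute_assoc[OF rl_kernel_powr_cont[of c] rl_kernel_powr_cont[of 1] k] c t
    by (simp add: conv_commute[of "?g 1" "?g c"])
  also have "\<dots> = conv (?g 1) (\<lambda>s. a * ?g c s + conv (?g c) k s) t"
    unfolding conv_mult_right[symmetric]
    by (intro conv_add_right[symmetric] conv_exists_mult_right powr_cont_conv_exists[OF rl_kernel_powr_cont rl_kernel_powr_cont]
        powr_cont_conv_exists[OF rl_kernel_powr_cont ck(1)]) (use c t in auto)
  finally show ?thesis .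
qed

lemma RL_integral_of_primitive_has_derivative:
  assumes k: "k \<in> powr_cont 0 T" and w: "\<And>t. 0 < t \<Longrightarrow> t \<le> T \<Longrightarrow> w t = a + conv (rl_kernel 1) k t"
    and c: "0 < c" and t: "0 < t" "t < T"
  shows "(RL_integral c w has_vector_derivative a * rl_kernel c t + conv (rl_kernel c) k t) (at t)"
proof -
  let ?h = "\<lambda>s. a * rl_kernel c s + conv (rl_kernel c) k s"
  have "conv (rl_kernel c) k \<in> powr_cont (c - 1 + 0 + 1) T"
    using c by (intro powr_cont_conv[OF rl_kernel_powr_cont k]) auto
  then have "conv (rl_kernel c) k \<in> powr_cont (c - 1) T"
    by (rule powr_cont_mono) auto
  then have h: "?h \<in> powr_cont (c - 1) T"
    by (intro powr_cont_add powr_cont_mult_left rl_kernel_powr_cont)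
  have "(RL_integral c w has_vector_derivative ?h t) (at t within {0<..T})"
    by (rule has_vector_derivative_transform[OF _ _ powr_cont_conv_1_has_derivative[OF h]])
       (use c t RL_integral_of_primitive[OF k w c] in auto)
  then have "(RL_integral c w has_vector_derivative ?h t) (at t within {0<..<T})"
    by (rule at_within_Ioo_of_Ioc)
  then show ?thesis
    using t by (subst (asm) has_vector_derivative_within_open) auto
qed

text \<open>The second condition reads a * g(1 - \<gamma>) + I(1 - \<gamma>) k -> 0; here the second
  summand tends to 0, while the first grows like t powr -\<gamma> unless a = 0. Then V' = I(2 -
  \<alpha>) k tends to 0 because its order is positive, and V does because w is bounded near
  0.\<close>

lemma uniqueness_C2:
  assumes T: "0 < T" and \<alpha>: "1 < \<alpha>" "\<alpha> < 2" and \<beta>: "0 \<le> \<beta>" and \<gamma>: "0 < \<gamma>" "\<gamma> \<le> \<alpha> - 1"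
    and w: "w \<in> Ck_minus1 2 T" and sol: "solves_problem T \<alpha> \<beta> \<gamma> m (\<lambda>_. 0) 0 0 w"
    and t: "0 < t" "t < T"
  shows "w t = 0"
proof -
  obtain a k where k: "k \<in> powr_cont 0 T" and wk: "\<And>t. 0 < t \<Longrightarrow> t \<le> T \<Longrightarrow> w t = a + conv (rl_kernel 1) k t"
    and wP: "w \<in> powr_cont 0 T"
    using w by (rule Ck_minus1_2_decomp) blast
  let ?V = "RL_integral (2 - \<alpha>) w"
  have "solves_equation T \<alpha> m (\<lambda>_. 0) w"
    using sol by (simp add: solves_problem_def)
  then obtain v where ex: "\<And>t. 0 < t \<Longrightarrow> t < T \<Longrightarrow> RL_integral_exists (2 - \<alpha>) w t"
    and V: "\<And>t. 0 < t \<Longrightarrow> t < T \<Longrightarrow> (?V has_vector_derivative v t) (at t)"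
    and v: "\<And>t. 0 < t \<Longrightarrow> t < T \<Longrightarrow> (v has_vector_derivative of_real m * w t) (at t)"
    by (rule homogeneous_equationE[OF \<alpha>(1) less_imp_le[OF \<alpha>(2)]]) blast
  have "initial_condition2 T \<gamma> w 0"
    using sol by (simp add: solves_problem_def)
  then obtain l where l': "\<And>t. 0 < t \<Longrightarrow> t < T \<Longrightarrow> (RL_integral (1 - \<gamma>) w has_vector_derivative l t) (at t)"
    and l: "(l \<longlongrightarrow> 0) (at_right 0)"
    by (rule initial_condition2E[rotated 2]) (use \<alpha> \<gamma> in auto)
  have l_eq: "l t = a * rl_kernel (1 - \<gamma>) t + conv (rl_kernel (1 - \<gamma>)) k t" if "0 < t" "t < T" for t
    by (rule vector_derivative_unique_at[OF l'[OF that] RL_integral_of_primitive_has_derivative[OF k wk _ that]])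
       (use \<alpha> \<gamma> in auto)
  have a: "a = 0"
  proof -
    have "(conv (rl_kernel (1 - \<gamma>)) k \<longlongrightarrow> 0) (at_right 0)"
      by (rule powr_cont_tendsto_0[OF powr_cont_conv[OF rl_kernel_powr_cont k] T]) (use \<alpha> \<gamma> in auto)
    \<comment> \<open>Multiplication by t powr \<gamma> turns the singular term into the constant a
      * rGamma (1 - \<gamma>), while the product tends to 0.\<close>
    then have "((\<lambda>t. (l t - conv (rl_kernel (1 - \<gamma>)) k t) * of_real (t powr \<gamma>)) \<longlongrightarrow> (0 - 0) * of_real 0) (at_right 0)"
      using \<gamma> by (intro tendsto_intros l tendsto_eq_intros tendsto_powr') (auto simp: eventually_at_filter)
    moreover have "eventually (\<lambda>t. (l t - conv (rl_kernel (1 - \<gamma>)) k t) * of_real (t powr \<gamma>) = a * of_real (rGamma (1 - \<gamma>))) (at_right 0)"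
      using eventually_at_right_real[OF T]
    proof eventually_elim
      case (elim t)
      then have "t powr (- \<gamma>) * t powr \<gamma> = 1"
        by (simp add: powr_add[symmetric])
      then have "complex_of_real (t powr (- \<gamma>)) * of_real (t powr \<gamma>) = 1"
        by (metis of_real_1 of_real_mult)
      then show ?case
        using elim by (simp add: l_eq rl_kernel_def mult.assoc)
    qed
    ultimately have "((\<lambda>_. a * of_real (rGamma (1 - \<gamma>))) \<longlongrightarrow> (0 - 0) * of_real 0) (at_right (0 :: real))"
      by (rule Lim_transform_eventually)
    then have "a * of_real (rGamma (1 - \<gamma>)) = 0"
      by (simp add: tendsto_const_iff)
    then show ?thesis
      using rGamma_real_pos[of "1 - \<gamma>"] \<alpha> \<gamma> by simp
  qed
  have v_eq: "v t = conv (rl_kernel (2 - \<alpha>)) k t" if "0 < t" "t < T" for t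
  proof -
    have "v t = a * rl_kernel (2 - \<alpha>) t + conv (rl_kernel (2 - \<alpha>)) k t"
      by (rule vector_derivative_unique_at[OF V[OF that] RL_integral_of_primitive_has_derivative[OF k wk _ that]])
         (use \<alpha> in auto)
    then show ?thesis by (simp add: a)
  qed
  have ck: "conv (rl_kernel (2 - \<alpha>)) k \<in> powr_cont (2 - \<alpha> - 1 + 0 + 1) T"
    by (rule powr_cont_conv[OF rl_kernel_powr_cont k]) (use \<alpha> in auto)
  have "(conv (rl_kernel (2 - \<alpha>)) k \<longlongrightarrow> 0) (at_right 0)"
    by (rule powr_cont_tendsto_0[OF ck T]) (use \<alpha> in auto)
  moreover have "eventually (\<lambda>t. conv (rl_kernel (2 - \<alpha>)) k t = v t) (at_right 0)"
    using eventually_at_right_real[OF T] by eventually_elim (simp add: v_eq)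
  ultimately have v0: "(v \<longlongrightarrow> 0) (at_right 0)"
    by (rule Lim_transform_eventually)
  have V0: "(?V \<longlongrightarrow> 0) (at_right 0)"
    by (rule powr_cont_tendsto_0[OF RL_integral_powr_cont[OF wP] T]) (use \<alpha> in auto)
  show ?thesis
  proof (rule uniqueness_core[OF \<alpha>(1) less_imp_le[OF \<alpha>(2)] _ _ ex V v V0 v0 t])
    show "continuous_on {0<..<T} w"
      by (rule continuous_on_subset[OF powr_cont_continuous_on[OF wP]]) auto
    show "set_integrable lborel {0<..<t} w" if "0 < t" "t < T" for t
      using that by (intro powr_cont_integrable[OF wP]) auto
  qed
qed

text \<open>The problem is posed on the open interval, whereas C^2_{-1} functions live on (0, T];
  continuity from the left covers the endpoint.\<close>

lemma continuous_zero_at_right_end: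
  fixes w :: "real \<Rightarrow> complex"
  assumes "continuous_on {0<..T} w" "\<And>t. 0 < t \<Longrightarrow> t < T \<Longrightarrow> w t = 0" "0 < t" "t \<le> T"
  shows "w t = 0"
proof (cases "t = T")
  case True
  have "(w \<longlongrightarrow> w T) (at T within {0<..T})"
    using assms True by (auto simp: continuous_on_def)
  then have "(w \<longlongrightarrow> w T) (at T within {0<..<T})"
    by (rule tendsto_within_subset) auto
  moreover have "at T within {0<..<T} = at_left T"
    using assms True by (intro at_within_nhd[of _ "{0<..}"]) auto
  ultimately have lim: "(w \<longlongrightarrow> w T) (at_left T)"
    by simp
  have "eventually (\<lambda>t. t \<in> {0<..<T}) (at_left T)"
    using assms True by (intro eventually_at_left_real) simp
  then have "eventually (\<lambda>t. w t = 0) (at_left T)"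
    by (rule eventually_mono) (simp add: assms(2))
  with lim have "((\<lambda>_. 0) \<longlongrightarrow> w T) (at_left T)"
    by (rule Lim_transform_eventually)
  then have "w T = 0"
    by (simp add: tendsto_const_iff)
  then show ?thesis using True by simp
qed (use assms in simp)

text \<open>Uniqueness in (A) fails for \<alpha> = 2 and \<gamma> < 1: the function G(2) solves the
  homogeneous equation and vanishes at 0, and its derivative of order \<gamma> is G(2 - \<gamma>),
  which also tends to 0. In (B) uniqueness is sought among functions continuous on (0, T): for
  \<alpha> < 2 and c1 nonzero, \<open>u_0\<close> grows like t powr (\<alpha> - 2) and lies outside
  C^2_{-1}, while without continuity, for m = 0 and \<alpha> < 2, a change of value at one point
  would go unnoticed.\<close>

theorem theorem2p3:
  fixes T m \<alpha> \<beta> :: real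
  assumes "0 < T" and "1 < \<alpha>" and "\<alpha> \<le> 2" and "0 \<le> \<beta>" and "\<beta> \<le> 2 - \<alpha>"
  defines "e1 \<equiv> (\<lambda>t::real. (t powr (\<alpha> - 1)) *\<^sub>R mittag_leffler \<alpha> \<alpha> (of_real (m * t powr \<alpha>)))"
    and "e2 \<equiv> (\<lambda>t::real. (t powr (\<alpha> - 2)) *\<^sub>R mittag_leffler \<alpha> (\<alpha> - 1) (of_real (m * t powr \<alpha>)))"
  shows
    "(\<forall>\<gamma> f. 0 < \<gamma> \<and> \<gamma> \<le> \<alpha> - 1 \<and>
        (\<alpha> < 2 \<longrightarrow> f \<in> Ck_minus1 1 T) \<and> (\<alpha> = 2 \<longrightarrow> f \<in> C_minus1 T) \<longrightarrow>
        (let u_f = (\<lambda>t. LBINT s=0..t. f (t - s) * e1 s) in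
          u_f \<in> Ck_minus1 2 T \<and> solves_problem T \<alpha> \<beta> \<gamma> m f 0 0 u_f \<and>
          (\<alpha> < 2 \<or> \<gamma> = 1 \<longrightarrow>
            (\<forall>u \<in> Ck_minus1 2 T. solves_problem T \<alpha> \<beta> \<gamma> m f 0 0 u \<longrightarrow>
              (\<forall>t\<in>{0<..T}. u t = u_f t)))))
     \<and>
     (\<forall>c1 c2 :: real.
        (let u_0 = (\<lambda>t. of_real c2 * e1 t + of_real c1 * e2 t) in
          continuous_on {0<..<T} u_0 \<and> solves_problem T \<alpha> \<beta> (\<alpha> - 1) m (\<lambda>_. 0) c1 c2 u_0 \<and>
          (\<forall>u. continuous_on {0<..<T} u \<and> solves_problem T \<alpha> \<beta> (\<alpha> - 1) m (\<lambda>_. 0) c1 c2 u \<longrightarrow>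
            (\<forall>t\<in>{0<..<T}. u t = u_0 t))))
     \<and> initial_condition1 T \<alpha> \<beta> e1 0 \<and> initial_condition2 T (\<alpha> - 1) e1 1
     \<and> initial_condition1 T \<alpha> \<beta> e2 1 \<and> initial_condition2 T (\<alpha> - 1) e2 0"
proof -
  note hyps = assms(1-5)
  have e1: "e1 = ml_kernel \<alpha> m \<alpha>" and e2: "e2 = ml_kernel \<alpha> m (\<alpha> - 1)"
    by (auto simp: e1_def e2_def ml_kernel_def fun_eq_iff)
  have A: "u_f \<in> Ck_minus1 2 T \<and> solves_problem T \<alpha> \<beta> \<gamma> m f 0 0 u_f \<and>
          (\<alpha> < 2 \<or> \<gamma> = 1 \<longrightarrow>
            (\<forall>u \<in> Ck_minus1 2 T. solves_problem T \<alpha> \<beta> \<gamma> m f 0 0 u \<longrightarrow> (\<forall>t\<in>{0<..T}. u t = u_f t)))"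
    if \<gamma>: "0 < \<gamma>" "\<gamma> \<le> \<alpha> - 1" and f1: "\<alpha> < 2 \<longrightarrow> f \<in> Ck_minus1 1 T" and f2: "\<alpha> = 2 \<longrightarrow> f \<in> C_minus1 T"
      and u_f: "u_f = (\<lambda>t::real. LBINT s=0..t. f (t - s) * e1 s)" for \<gamma> f u_f
  proof -
    have conv_u_f: "conv f (ml_kernel \<alpha> m \<alpha>) t = u_f t" if "0 < t" for t
      using that by (simp add: u_f e1 conv_eq_interval_integral)
    obtain p where p: "-1 < p" "f \<in> powr_cont p T"
    proof (cases "\<alpha> < 2")
      case True
      then have "f \<in> Ck_minus1 1 T" using f1 by simp
      then have "f \<in> powr_cont 0 T" by (rule Ck_minus1_1_decomp)
      then show ?thesis using that[of 0] by simp
    next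
      case False
      then have "f \<in> C_minus1 T" using f2 hyps by simp
      then show ?thesis by (rule C_minus1_E) (rule that)
    qed
    have "conv f (ml_kernel \<alpha> m \<alpha>) \<in> Ck_minus1 2 T"
    proof (cases "\<alpha> < 2")
      case True
      then show ?thesis using conv_ml_kernel_C2_less[of f T \<alpha> m] f1 hyps by simp
    next
      case False
      then have "\<alpha> = 2" using hyps by simp
      then show ?thesis using conv_ml_kernel_C2_eq[OF p(2,1), of m] by simp
    qed
    then have C2: "u_f \<in> Ck_minus1 2 T"
      by (rule Ck_minus1_cong) (simp add: conv_u_f)
    have "solves_problem T \<alpha> \<beta> \<gamma> m f 0 0 (conv f (ml_kernel \<alpha> m \<alpha>))"
      by (rule conv_ml_kernel_solves_problem[OF p(2,1)]) (use hyps \<gamma> in auto)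
    then have sol: "solves_problem T \<alpha> \<beta> \<gamma> m f 0 0 u_f"
      by (rule solves_problem_cong[rotated -1]) (use hyps \<gamma> conv_u_f in auto)
    have uniq: "u t = u_f t" if "\<alpha> < 2 \<or> \<gamma> = 1" and u: "u \<in> Ck_minus1 2 T" "solves_problem T \<alpha> \<beta> \<gamma> m f 0 0 u"
      and t: "0 < t" "t \<le> T" for u t
    proof -
      define w where "w = (\<lambda>t. u t - u_f t)"
      have w: "w \<in> Ck_minus1 2 T"
        unfolding w_def by (rule Ck_minus1_diff[OF u(1) C2])
      have wsol: "solves_problem T \<alpha> \<beta> \<gamma> m (\<lambda>_. 0) 0 0 w"
        unfolding w_def by (rule solves_problem_diff[OF _ _ _ _ u(2) sol]) (use hyps \<gamma> in auto)
      have "w \<in> powr_cont 0 T"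
        using w by (rule Ck_minus1_2_decomp)
      then have wc: "continuous_on {0<..T} w"
        by (rule powr_cont_continuous_on)
      have "w t = 0" if t: "0 < t" "t < T" for t
      proof (cases "\<alpha> < 2")
        case True
        then show ?thesis
          using uniqueness_C2[OF hyps(1,2) True hyps(4) \<gamma> w wsol t] by simp
      next
        case False
        \<comment> \<open>With \<alpha> = 2 the restriction leaves \<gamma> = 1 = \<alpha> - 1, so
          the argument for maximal \<gamma> applies.\<close>
        then have "\<gamma> = \<alpha> - 1" using \<open>\<alpha> < 2 \<or> \<gamma> = 1\<close> hyps by linarith
        moreover have "continuous_on {0<..<T} w"
          by (rule continuous_on_subset[OF wc]) auto
        ultimately show ?thesis
          using uniqueness_gamma_max[OF hyps _ _ t] wsol by simp
      qed
      then have "w t = 0"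
        by (rule continuous_zero_at_right_end[OF wc _ t])
      then show ?thesis by (simp add: w_def)
    qed
    show ?thesis
      by (intro conjI impI ballI C2 sol; rule uniq) (assumption | simp only: greaterThanAtMost_iff)+
  qed
  have B: "continuous_on {0<..<T} u_0 \<and> solves_problem T \<alpha> \<beta> (\<alpha> - 1) m (\<lambda>_. 0) c1 c2 u_0 \<and>
          (\<forall>u. continuous_on {0<..<T} u \<and> solves_problem T \<alpha> \<beta> (\<alpha> - 1) m (\<lambda>_. 0) c1 c2 u \<longrightarrow>
            (\<forall>t\<in>{0<..<T}. u t = u_0 t))"
    if u_0: "u_0 = (\<lambda>t. of_real c2 * e1 t + of_real c1 * e2 t)" for c1 c2 u_0
  proof -
    have sol: "solves_problem T \<alpha> \<beta> (\<alpha> - 1) m (\<lambda>_. 0) c1 c2 u_0"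
      unfolding u_0 e1 e2 by (rule ml_kernel_combination_solves_problem[OF hyps])
    have "continuous_on {0<..T} e1" "continuous_on {0<..T} e2"
      unfolding e1 e2 using hyps by (auto intro!: powr_cont_continuous_on[OF ml_kernel_powr_cont])
    then have cont: "continuous_on {0<..<T} u_0"
      unfolding u_0 by (intro continuous_intros) (auto elim: continuous_on_subset)
    have uniq: "u t = u_0 t" if u: "continuous_on {0<..<T} u" "solves_problem T \<alpha> \<beta> (\<alpha> - 1) m (\<lambda>_. 0) c1 c2 u"
      and t: "0 < t" "t < T" for u t
    proof -
      have "solves_problem T \<alpha> \<beta> (\<alpha> - 1) m (\<lambda>_. 0) 0 0 (\<lambda>t. u t - u_0 t)"
        by (rule solves_problem_diff[OF _ _ _ _ u(2) sol]) (use hyps in auto)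
      then have "u t - u_0 t = 0"
        by (rule uniqueness_gamma_max[OF hyps continuous_on_diff[OF u(1) cont] _ t])
      then show ?thesis by simp
    qed
    show ?thesis
      by (intro conjI allI impI ballI cont sol; elim conjE; rule uniq) (assumption | simp only: greaterThanLessThan_iff)+
  qed
  have C: "initial_condition1 T \<alpha> \<beta> e1 0"
    unfolding e1 by (rule initial_condition1_0I[OF _ _ _ _ ml_kernel_powr_cont]) (use hyps in auto)
  have D: "initial_condition1 T \<alpha> \<beta> e2 1" "initial_condition2 T (\<alpha> - 1) e1 1" "initial_condition2 T (\<alpha> - 1) e2 0"
    unfolding e1 e2 by (fact ml_kernel_IC1[OF hyps(1,2,4)] ml_kernel_IC2[OF hyps(1-3)])+
  show ?thesis
    unfolding Let_def
  proof (rule conjI, intro allI impI)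
    fix \<gamma> f
    assume "0 < \<gamma> \<and> \<gamma> \<le> \<alpha> - 1 \<and> (\<alpha> < 2 \<longrightarrow> f \<in> Ck_minus1 1 T) \<and> (\<alpha> = 2 \<longrightarrow> f \<in> C_minus1 T)"
    then have "0 < \<gamma>" "\<gamma> \<le> \<alpha> - 1" "\<alpha> < 2 \<longrightarrow> f \<in> Ck_minus1 1 T" "\<alpha> = 2 \<longrightarrow> f \<in> C_minus1 T"
      by blast+
    from A[OF this refl]
    show "(\<lambda>t. LBINT s=0..t. f (t - s) * e1 s) \<in> Ck_minus1 2 T \<and>
        solves_problem T \<alpha> \<beta> \<gamma> m f 0 0 (\<lambda>t. LBINT s=0..t. f (t - s) * e1 s) \<and>
        (\<alpha> < 2 \<or> \<gamma> = 1 \<longrightarrow>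
          (\<forall>u \<in> Ck_minus1 2 T. solves_problem T \<alpha> \<beta> \<gamma> m f 0 0 u \<longrightarrow>
            (\<forall>t\<in>{0<..T}. u t = (LBINT s=0..t. f (t - s) * e1 s))))" .
  qed (rule conjI, intro allI, rule B[OF refl], intro conjI C D)
qed

end
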